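(* For a nonzero commutative ring $R$ the following assertions are equivalent: (i) $\operatorname{Spec}(R)$ has finitely many connected components. (ii) $R$ has finitely many idempotents. (iii) There is an isomorphism of rings $R\simeq\prod_{k=1}^{n}R/(1-e_k)$ for some natural number $n\ge 1$ and some primitive idempotents $e_1,\ldots,e_n$ of $R$. (iv) There is an isomorphism of rings $R\simeq\prod_{i\in\kappa}R/(1-e_i)$, where each $e_i$ is a primitive idempotent of $R$ and $\kappa$ is the cardinal (possibly infinite) of the set of connected components of $\operatorname{Spec}(R)$. (v) The unit ideal of $R$ is generated by a set of primitive idempotents of $R$. (vi) Every regular ideal of $R$ is finitely generated. (vii) Every max-regular ideal of $R$ is finitely generated. (viii) The connected components of $\operatorname{Spec}(R)$ are exactly the subsets of the form $D(e)$ where $e$ is a primitive idempotent of $R$.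
   Context: A primitive idempotent of $R$ is a nonzero idempotent $e\in R$ such that if $ee'=e'$ for some nonzero idempotent $e'\in R$, then $e=e'$. A regular ideal of $R$ is an ideal generated by a set of idempotent elements of $R$. A max-regular ideal of $R$ is a maximal element (under inclusion) of the set of proper regular ideals of $R$. For $r\in R$, $D(r)=\{\mathfrak{p}\in\operatorname{Spec}(R): r\notin\mathfrak{p}\}$. Connected spaces are nonempty by convention. *)

theory Defs
  imports "HOL-Algebra.QuotRing" "HOL-Analysis.Abstract_Topology_2"
begin

definition ring_idempotents :: "('a, 'b) ring_scheme \<Rightarrow> 'a set"
  where "ring_idempotents R = {e \<in> carrier R. e \<otimes>\<^bsub>R\<^esub> e = e}"

definition primitive_idempotent :: "('a, 'b) ring_scheme \<Rightarrow> 'a \<Rightarrow> bool"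
  where "primitive_idempotent R e \<longleftrightarrow>
    e \<in> ring_idempotents R \<and> e \<noteq> \<zero>\<^bsub>R\<^esub> \<and>
    (\<forall>e' \<in> ring_idempotents R. e' \<noteq> \<zero>\<^bsub>R\<^esub> \<longrightarrow> e \<otimes>\<^bsub>R\<^esub> e' = e' \<longrightarrow> e = e')"

definition finitely_generated_ideal :: "('a, 'b) ring_scheme \<Rightarrow> 'a set \<Rightarrow> bool"
  where "finitely_generated_ideal R I \<longleftrightarrow> (\<exists>S. finite S \<and> S \<subseteq> carrier R \<and> I = Idl\<^bsub>R\<^esub> S)"

definition regular_ideal :: "('a, 'b) ring_scheme \<Rightarrow> 'a set \<Rightarrow> bool"
  where "regular_ideal R I \<longleftrightarrow> (\<exists>S. S \<subseteq> ring_idempotents R \<and> I = Idl\<^bsub>R\<^esub> S)"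

definition max_regular_ideal :: "('a, 'b) ring_scheme \<Rightarrow> 'a set \<Rightarrow> bool"
  where "max_regular_ideal R M \<longleftrightarrow>
    regular_ideal R M \<and> M \<noteq> carrier R \<and>
    (\<forall>J. regular_ideal R J \<and> J \<noteq> carrier R \<and> M \<subseteq> J \<longrightarrow> J = M)"

definition prime_spectrum :: "('a, 'b) ring_scheme \<Rightarrow> 'a set set"
  where "prime_spectrum R = {p. primeideal p R}"

definition basic_open :: "('a, 'b) ring_scheme \<Rightarrow> 'a \<Rightarrow> 'a set set"
  where "basic_open R r = {p \<in> prime_spectrum R. r \<notin> p}"

text \<open>The open sets are the complements of the sets of primes containing a given subset \<open>E\<close> of \<open>R\<close>.\<close>

definition zariski_topology :: "('a, 'b) ring_scheme \<Rightarrow> 'a set topology"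
  where "zariski_topology R =
    topology (\<lambda>U. \<exists>E \<subseteq> carrier R. U = prime_spectrum R - {p \<in> prime_spectrum R. E \<subseteq> p})"

lemma istopology_zariski:
  "istopology (\<lambda>U. \<exists>E \<subseteq> carrier R. U = prime_spectrum R - {p \<in> prime_spectrum R. E \<subseteq> p})"
  (is "istopology ?open")
  unfolding istopology_def
proof (intro conjI allI impI)
  fix S T assume "?open S" "?open T"
  then obtain E F where E: "E \<subseteq> carrier R" "S = prime_spectrum R - {p \<in> prime_spectrum R. E \<subseteq> p}"
    and F: "F \<subseteq> carrier R" "T = prime_spectrum R - {p \<in> prime_spectrum R. F \<subseteq> p}"
    by (elim exE conjE) (rule that)
  define G where "G = {x \<otimes>\<^bsub>R\<^esub> y | x y. x \<in> E \<and> y \<in> F} \<inter> carrier R"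
  have "G \<subseteq> p \<longleftrightarrow> E \<subseteq> p \<or> F \<subseteq> p" if "p \<in> prime_spectrum R" for p
  proof -
    interpret primeideal p R using that by (simp add: prime_spectrum_def)
    show ?thesis
    proof
      assume G: "G \<subseteq> p"
      show "E \<subseteq> p \<or> F \<subseteq> p"
      proof (rule ccontr)
        assume "\<not> (E \<subseteq> p \<or> F \<subseteq> p)"
        then obtain x y where xy: "x \<in> E" "x \<notin> p" "y \<in> F" "y \<notin> p" by blast
        then have "x \<otimes>\<^bsub>R\<^esub> y \<in> G" using E(1) F(1) by (auto simp: G_def)
        then show False using G xy E(1) F(1) I_prime by blast
      qed
    next
      assume "E \<subseteq> p \<or> F \<subseteq> p"
      then show "G \<subseteq> p"
        unfolding G_def using E(1) F(1) I_l_closed I_r_closed by blast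
    qed
  qed
  then have "S \<inter> T = prime_spectrum R - {p \<in> prime_spectrum R. G \<subseteq> p}"
    using E(2) F(2) by blast
  moreover have "G \<subseteq> carrier R" by (simp add: G_def)
  ultimately show "?open (S \<inter> T)" by blast
next
  fix K assume K: "\<forall>U\<in>K. ?open U"
  define G where
    "G = \<Union>{E. E \<subseteq> carrier R \<and> prime_spectrum R - {p \<in> prime_spectrum R. E \<subseteq> p} \<in> K}"
  have "\<Union>K = prime_spectrum R - {p \<in> prime_spectrum R. G \<subseteq> p}"
  proof (intro subset_antisym subsetI)
    fix p assume "p \<in> \<Union>K"
    then obtain U where U: "U \<in> K" "p \<in> U" by blast
    obtain E where E: "E \<subseteq> carrier R" "U = prime_spectrum R - {p \<in> prime_spectrum R. E \<subseteq> p}"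
      using bspec[OF K U(1)] by (elim exE conjE) (rule that)
    have "E \<subseteq> G" unfolding G_def using E U(1) by (intro Union_upper) simp
    then show "p \<in> prime_spectrum R - {p \<in> prime_spectrum R. G \<subseteq> p}"
      using U(2) unfolding E(2) by blast
  next
    fix p assume "p \<in> prime_spectrum R - {p \<in> prime_spectrum R. G \<subseteq> p}"
    then show "p \<in> \<Union>K" unfolding G_def by blast
  qed
  moreover have "G \<subseteq> carrier R" by (auto simp: G_def)
  ultimately show "?open (\<Union>K)" by blast
qed

lemma openin_zariski:
  "openin (zariski_topology R) U \<longleftrightarrow>
    (\<exists>E \<subseteq> carrier R. U = prime_spectrum R - {p \<in> prime_spectrum R. E \<subseteq> p})"
  unfolding zariski_topology_def topology_inverse'[OF istopology_zariski] ..

lemma topspace_zariski: "topspace (zariski_topology R) = prime_spectrum R"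
proof -
  have "prime_spectrum R = prime_spectrum R - {p \<in> prime_spectrum R. carrier R \<subseteq> p}"
    by (auto simp: prime_spectrum_def)
      (metis additive_subgroup.a_subset ideal.axioms(1) primeideal.I_notcarr
        primeideal.axioms(1) subset_antisym)
  then have "openin (zariski_topology R) (prime_spectrum R)"
    unfolding openin_zariski by blast
  moreover have "U \<subseteq> prime_spectrum R" if "openin (zariski_topology R) U" for U
    using that unfolding openin_zariski by blast
  ultimately show ?thesis
    by (simp add: openin_subset subset_antisym)
qed

text \<open>The ring analogue of the library's \<open>product_group\<close>, for an arbitrary index set.\<close>

definition product_ring :: "'i set \<Rightarrow> ('i \<Rightarrow> ('a, 'b) ring_scheme) \<Rightarrow> ('i \<Rightarrow> 'a) ring"
  where "product_ring I S =
    \<lparr>carrier = (\<Pi>\<^sub>E i\<in>I. carrier (S i)),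
     monoid.mult = (\<lambda>x y. \<lambda>i\<in>I. x i \<otimes>\<^bsub>S i\<^esub> y i),
     one = (\<lambda>i\<in>I. \<one>\<^bsub>S i\<^esub>),
     zero = (\<lambda>i\<in>I. \<zero>\<^bsub>S i\<^esub>),
     add = (\<lambda>x y. \<lambda>i\<in>I. x i \<oplus>\<^bsub>S i\<^esub> y i)\<rparr>"

lemma product_ring_cring:
  assumes "\<And>i. i \<in> I \<Longrightarrow> cring (S i)"
  shows "cring (product_ring I S)"
proof -
  note S = cring.cring_simprules[OF assms]
  show ?thesis
  proof (rule cringI)
    show "abelian_group (product_ring I S)"
    proof (rule abelian_groupI)
      fix x assume "x \<in> carrier (product_ring I S)"
      then show "\<exists>y\<in>carrier (product_ring I S). y \<oplus>\<^bsub>product_ring I S\<^esub> x = \<zero>\<^bsub>product_ring I S\<^esub>"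
        by (intro bexI[of _ "\<lambda>i\<in>I. \<ominus>\<^bsub>S i\<^esub> x i"])
          (auto simp: product_ring_def PiE_iff S(3,9) intro!: restrict_ext)
    qed (simp_all add: product_ring_def PiE_iff fun_eq_iff extensional_def S(1,2,7,8,10,16,23))
    show "comm_monoid (product_ring I S)"
      by (rule comm_monoidI)
        (simp_all add: product_ring_def PiE_iff fun_eq_iff extensional_def S(5,6,11,12,14,24)
          monoid.r_one[OF comm_monoid.axioms(1)[OF cring.axioms(2)[OF assms]]])
  qed (simp_all add: product_ring_def PiE_iff fun_eq_iff extensional_def S(13))
qed

end

theory Submission
  imports Defs "HOL-Algebra.Free_Abelian_Groups" "HOL-Algebra.Multiplicative_Group"
begin

text \<open>
  Clopen subsets of the spectrum are exactly the sets \<open>D(e)\<close> with \<open>e\<close>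
  idempotent, so \<open>D(e)\<close> is a connected component when \<open>e\<close> is primitive, and in
  general a union of components. Finitely many components thus leave room for only finitely many
  idempotents, and then an idempotent that is minimal among those outside a given prime is primitive, so
  the primitive idempotents generate the unit ideal. Conversely, a finite set of primitive idempotents
  generating the unit ideal separates all idempotents. For max-regular ideals, the idempotents of a prime
  containing all primitive idempotents would generate a max-regular ideal; if it is finitely generated,
  it is generated by one idempotent \<open>f\<close>, and \<open>1 - f\<close> is a primitive idempotent
  outside the prime.

  The delicate case is a product indexed by the set \<open>K\<close> of components when \<open>K\<close>
  is infinite. Its idempotents contain a copy of the power set of \<open>K\<close>, and an independent
  family of subsets of \<open>K\<close> indexed by \<open>K\<close> itself allows a diagonal argument:
  for every component \<open>C\<close> pick the idempotent of the \<open>C\<close>-th set or of its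
  complement, whichever vanishes on \<open>C\<close>. By independence some prime avoids all of these
  idempotents, and so it lies in no component.
\<close>

section \<open>Prime ideals and the Zariski topology\<close>

text \<open>Any two elements of the union lie in a common member of the chain, so sums stay inside,
  and a nonempty chain supplies zero. This is the upper bound in the Zorn argument for prime
  ideals.\<close>

lemma (in ring) ideal_Union_chain:
  assumes "\<C> \<noteq> {}" "subset.chain {I. ideal I R} \<C>"
  shows "ideal (\<Union>\<C>) R"
proof (rule idealI)
  have ideals: "ideal I R" if "I \<in> \<C>" for I
    using assms(2) that by (auto simp: subset_chain_def)
  have dir: "\<exists>K\<in>\<C>. x \<in> K \<and> y \<in> K" if xy: "x \<in> \<Union>\<C>" "y \<in> \<Union>\<C>" for x y
  proof -
    obtain I J where "I \<in> \<C>" "J \<in> \<C>" "x \<in> I" "y \<in> J" using xy by blast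
    moreover from this have "I \<subseteq> J \<or> J \<subseteq> I" using assms(2) by (auto simp: subset_chain_def)
    ultimately show ?thesis by (meson subsetD)
  qed
  show "subgroup (\<Union>\<C>) (add_monoid R)"
  proof (rule add.subgroupI)
    show "\<Union>\<C> \<subseteq> carrier R" using ideal.Icarr[OF ideals] by (meson Union_iff subsetI)
    obtain I where I: "I \<in> \<C>" using assms(1) by blast
    then show "\<Union>\<C> \<noteq> {}"
      using additive_subgroup.zero_closed[OF ideal.axioms(1)[OF ideals[OF I]]] by blast
    show "\<ominus> x \<in> \<Union>\<C>" if "x \<in> \<Union>\<C>" for x
      using that additive_subgroup.a_inv_closed[OF ideal.axioms(1)[OF ideals]] by (meson Union_iff)
    show "x \<oplus> y \<in> \<Union>\<C>" if "x \<in> \<Union>\<C>" "y \<in> \<Union>\<C>" for x y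
      using dir[OF that] additive_subgroup.a_closed[OF ideal.axioms(1)[OF ideals]] by (meson UnionI)
  qed
  show "x \<otimes> a \<in> \<Union>\<C>" "a \<otimes> x \<in> \<Union>\<C>" if "a \<in> \<Union>\<C>" "x \<in> carrier R" for a x
    using that ideal.I_l_closed[OF ideals] ideal.I_r_closed[OF ideals] by (meson Union_iff)+
qed (rule ring_axioms)

lemma set_add_iff: "z \<in> set_add R I J \<longleftrightarrow> (\<exists>a\<in>I. \<exists>b\<in>J. z = a \<oplus>\<^bsub>R\<^esub> b)"
  unfolding set_add_def' by blast

lemma (in ring) subset_set_add:
  assumes "ideal I R" "ideal J R"
  shows "I \<subseteq> set_add R I J" "J \<subseteq> set_add R I J"
proof -
  interpret I: ideal I R by fact
  interpret J: ideal J R by fact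
  show "I \<subseteq> set_add R I J"
    using J.zero_closed I.Icarr r_zero unfolding set_add_iff subset_iff by metis
  show "J \<subseteq> set_add R I J"
    using I.zero_closed J.Icarr l_zero unfolding set_add_iff subset_iff by metis
qed

text \<open>An ideal maximal among those that contain \<open>I\<close> and miss every power of
  \<open>c\<close> is prime: if \<open>x\<close> and \<open>y\<close> lie outside it, enlarging it
  by either one captures a power of \<open>c\<close>, and the product of the two powers falls into
  the ideal once \<open>x \<otimes> y\<close> does.\<close>

lemma (in cring) exists_primeideal_avoiding_powers:
  assumes "ideal I R" "c \<in> carrier R" and avoid: "\<And>n::nat. c [^] n \<notin> I"
  obtains P where "primeideal P R" "I \<subseteq> P" "c \<notin> P"
proof -
  define \<A> where "\<A> = {J. ideal J R \<and> I \<subseteq> J \<and> (\<forall>n::nat. c [^] n \<notin> J)}"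
  have "\<exists>M\<in>\<A>. \<forall>X\<in>\<A>. M \<subseteq> X \<longrightarrow> X = M"
  proof (rule subset_Zorn_nonempty)
    show "\<A> \<noteq> {}" using assms by (auto simp: \<A>_def)
    fix \<C> assume C: "\<C> \<noteq> {}" "subset.chain \<A> \<C>"
    have CA: "J \<in> \<A>" if "J \<in> \<C>" for J
      using C(2) that by (auto simp: subset_chain_def)
    have "subset.chain {I. ideal I R} \<C>"
      using C(2) by (auto simp: subset_chain_def \<A>_def)
    then have "ideal (\<Union>\<C>) R" by (rule ideal_Union_chain[OF C(1)])
    moreover obtain J where "J \<in> \<C>" using C(1) by (meson ex_in_conv)
    then have "I \<subseteq> \<Union>\<C>" using CA[of J] by (auto simp: \<A>_def)
    moreover have "c [^] n \<notin> \<Union>\<C>" for n :: nat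
    proof
      assume "c [^] n \<in> \<Union>\<C>"
      then obtain J where "J \<in> \<C>" "c [^] n \<in> J" by (rule UnionE)
      then show False using CA by (simp add: \<A>_def)
    qed
    ultimately show "\<Union>\<C> \<in> \<A>" by (simp add: \<A>_def)
  qed
  then obtain M where MA: "M \<in> \<A>" and Mmax: "\<forall>X\<in>\<A>. M \<subseteq> X \<longrightarrow> X = M"
    by (rule bexE)
  have M: "ideal M R" "I \<subseteq> M" "c [^] n \<notin> M" for n :: nat
    using MA by (simp_all add: \<A>_def)
  have max: "\<exists>n::nat. c [^] n \<in> J" if "ideal J R" "M \<subseteq> J" "J \<noteq> M" for J
  proof (rule ccontr)
    assume "\<nexists>n::nat. c [^] n \<in> J"
    then have "J \<in> \<A>" using that M(2) by (auto simp: \<A>_def)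
    then show False using Mmax that by blast
  qed
  interpret M: ideal M R by fact
  have meets: "\<exists>(n::nat) m r. m \<in> M \<and> r \<in> carrier R \<and> c [^] n = m \<oplus> r \<otimes> x"
    if x: "x \<in> carrier R" "x \<notin> M" for x
  proof -
    have "ideal (set_add R M (PIdl x)) R"
      by (rule add_ideals[OF M(1) cgenideal_ideal[OF x(1)]])
    moreover have "M \<subseteq> set_add R M (PIdl x)" "x \<in> set_add R M (PIdl x)"
      using subset_set_add[OF M(1) cgenideal_ideal[OF x(1)]] cgenideal_self[OF x(1)] by blast+
    ultimately have "\<exists>n::nat. c [^] n \<in> set_add R M (PIdl x)"
      using max x by blast
    then show ?thesis unfolding set_add_iff cgenideal_def by blast
  qed
  have "primeideal M R"
  proof (rule primeidealI[OF M(1) is_cring])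
    show "carrier R \<noteq> M" using M(3) assms(2) by blast
    fix x y assume xy: "x \<in> carrier R" "y \<in> carrier R" "x \<otimes> y \<in> M"
    show "x \<in> M \<or> y \<in> M"
    proof (rule ccontr)
      assume "\<not> (x \<in> M \<or> y \<in> M)"
      then obtain n m r n' m' r' where
        1: "m \<in> M" "r \<in> carrier R" "c [^] (n::nat) = m \<oplus> r \<otimes> x" and
        2: "m' \<in> M" "r' \<in> carrier R" "c [^] (n'::nat) = m' \<oplus> r' \<otimes> y"
        using meets xy by metis
      note carr = 1(1)[THEN M.Icarr] 2(1)[THEN M.Icarr] 1(2) 2(2) xy(1,2)
      have "c [^] (n + n') = (m \<oplus> r \<otimes> x) \<otimes> (m' \<oplus> r' \<otimes> y)"
        using 1(3) 2(3) assms(2) by (simp add: nat_pow_mult[symmetric])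
      \<comment> \<open>Arranged so that every summand has one of the factors \<open>m\<close>,
        \<open>m'\<close> and \<open>x \<otimes> y\<close>, all of which lie in
        \<open>M\<close>.\<close>
      also have "\<dots> = (m' \<oplus> r' \<otimes> y) \<otimes> m \<oplus> (r \<otimes> x) \<otimes> m' \<oplus> (r \<otimes> r') \<otimes> (x \<otimes> y)"
        using carr by algebra
      also have "\<dots> \<in> M"
        using 1(1) 2(1) xy(3) carr by (simp add: M.I_l_closed M.a_closed)
      finally show False using M(3) by blast
    qed
  qed
  then show thesis using that M(2) M(3)[of 1] assms(2) by simp
qed

lemma (in cring) exists_primeideal_superset:
  assumes "ideal I R" "\<one> \<notin> I"
  obtains P where "primeideal P R" "I \<subseteq> P"
  using exists_primeideal_avoiding_powers[OF assms(1) one_closed] assms(2) by (metis nat_pow_one)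

lemma (in primeideal) one_notin: "\<one> \<notin> I"
  using I_notcarr one_imp_carrier by blast

lemma (in cring) ideal_annihilator:
  assumes "x \<in> carrier R"
  shows "ideal {y \<in> carrier R. y \<otimes> x = \<zero>} R"
proof (rule idealI)
  show "subgroup {y \<in> carrier R. y \<otimes> x = \<zero>} (add_monoid R)"
    by (rule add.subgroupI) (use assms in \<open>auto simp: l_distr l_minus\<close>)
next
  fix a b assume ab: "a \<in> {y \<in> carrier R. y \<otimes> x = \<zero>}" "b \<in> carrier R"
  then have "(b \<otimes> a) \<otimes> x = \<zero>" using assms by (simp add: m_assoc)
  with ab show "b \<otimes> a \<in> {y \<in> carrier R. y \<otimes> x = \<zero>}" "a \<otimes> b \<in> {y \<in> carrier R. y \<otimes> x = \<zero>}"
    by (simp_all add: m_comm)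
qed (rule ring_axioms)

text \<open>The annihilator of \<open>x\<close> is an ideal containing \<open>S\<close>. When
  \<open>S\<close> generates the unit ideal, taking \<open>y\<close> = 1 gives the test used below:
  an element killed by all generators is zero.\<close>

lemma (in cring) annihilates_Idl:
  assumes "S \<subseteq> carrier R" "x \<in> carrier R" "\<And>s. s \<in> S \<Longrightarrow> s \<otimes> x = \<zero>" "y \<in> Idl S"
  shows "y \<otimes> x = \<zero>"
  using genideal_minimal[OF ideal_annihilator[OF assms(2)], of S] assms by blast

section \<open>Idempotents and clopen subsets of the spectrum\<close>

lemma ring_idempotentsD: "e \<in> ring_idempotents R \<Longrightarrow> e \<in> carrier R"
  "e \<in> ring_idempotents R \<Longrightarrow> e \<otimes>\<^bsub>R\<^esub> e = e"
  by (auto simp: ring_idempotents_def)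

lemma primitive_idempotentD:
  assumes "primitive_idempotent R e"
  shows "e \<in> ring_idempotents R" "e \<in> carrier R" "e \<otimes>\<^bsub>R\<^esub> e = e" "e \<noteq> \<zero>\<^bsub>R\<^esub>"
    and "f \<in> ring_idempotents R \<Longrightarrow> e \<otimes>\<^bsub>R\<^esub> f = f \<Longrightarrow> f = \<zero>\<^bsub>R\<^esub> \<or> f = e"
  using assms by (auto simp: primitive_idempotent_def ring_idempotents_def)

context cring
begin

lemma idempotent_mult:
  assumes "e \<in> ring_idempotents R" "f \<in> ring_idempotents R"
  shows "e \<otimes> f \<in> ring_idempotents R"
proof -
  have "(e \<otimes> f) \<otimes> (e \<otimes> f) = (e \<otimes> e) \<otimes> (f \<otimes> f)"
    using assms[THEN ring_idempotentsD(1)] by algebra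
  then show ?thesis using assms by (simp add: ring_idempotents_def)
qed

lemma idempotent_compl:
  assumes "e \<in> ring_idempotents R"
  shows "\<one> \<ominus> e \<in> ring_idempotents R" "e \<otimes> (\<one> \<ominus> e) = \<zero>" "(\<one> \<ominus> e) \<otimes> e = \<zero>"
proof -
  note e = ring_idempotentsD[OF assms]
  have "(\<one> \<ominus> e) \<otimes> (\<one> \<ominus> e) = \<one> \<ominus> e \<oplus> (e \<otimes> e \<ominus> e)" using e(1) by algebra
  also have "\<dots> = \<one> \<ominus> e" using e(1) unfolding e(2) by algebra
  finally show "\<one> \<ominus> e \<in> ring_idempotents R" using e by (simp add: ring_idempotents_def)
  have "e \<otimes> (\<one> \<ominus> e) = e \<ominus> e \<otimes> e" using e(1) by algebra
  then show *: "e \<otimes> (\<one> \<ominus> e) = \<zero>" using e by (simp add: r_right_minus_eq)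
  then show "(\<one> \<ominus> e) \<otimes> e = \<zero>" using e(1) by (simp add: m_comm)
qed

text \<open>The product of \<open>e\<close> and 1 - \<open>e\<close> is zero, so a prime contains
  one of them; their sum is 1, so it cannot contain both.\<close>

lemma idempotent_notin_primeideal_iff:
  assumes "primeideal p R" "e \<in> ring_idempotents R"
  shows "e \<notin> p \<longleftrightarrow> \<one> \<ominus> e \<in> p"
proof -
  interpret p: primeideal p R by fact
  note e = ring_idempotentsD[OF assms(2)]
  have "e \<oplus> (\<one> \<ominus> e) = \<one>" using e(1) by algebra
  then have "\<not> (e \<in> p \<and> \<one> \<ominus> e \<in> p)" using p.one_notin p.a_closed by metis
  moreover have "e \<in> p \<or> \<one> \<ominus> e \<in> p"
    using idempotent_compl[OF assms(2)] e(1) p.I_prime p.zero_closed by (metis minus_closed one_closed)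
  ultimately show ?thesis by blast
qed

text \<open>If the annihilator of \<open>g\<close> were proper, some prime would contain it; that
  prime would contain 1 - \<open>g\<close> and hence miss \<open>g\<close>.\<close>

lemma idempotent_eq_zero:
  assumes "g \<in> ring_idempotents R" "\<And>p. primeideal p R \<Longrightarrow> g \<in> p"
  shows "g = \<zero>"
proof -
  note g = ring_idempotentsD[OF assms(1)]
  let ?J = "{y \<in> carrier R. y \<otimes> g = \<zero>}"
  have "\<one> \<in> ?J"
  proof (rule ccontr)
    assume "\<one> \<notin> ?J"
    then obtain p where "primeideal p R" "?J \<subseteq> p"
      using exists_primeideal_superset[OF ideal_annihilator[OF g(1)]] by metis
    then show False
      using idempotent_compl[OF assms(1)] assms idempotent_notin_primeideal_iff g(1) by blast
  qed
  then show ?thesis using g(1) by simp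
qed

lemma openin_basic_open: "r \<in> carrier R \<Longrightarrow> openin (zariski_topology R) (basic_open R r)"
  unfolding openin_zariski basic_open_def by (rule exI[of _ "{r}"]) auto

lemma basic_open_compl:
  assumes "e \<in> ring_idempotents R"
  shows "basic_open R (\<one> \<ominus> e) = prime_spectrum R - basic_open R e"
  using idempotent_notin_primeideal_iff[OF _ assms]
  by (auto simp: basic_open_def prime_spectrum_def)

lemma closedin_basic_open:
  assumes "e \<in> ring_idempotents R"
  shows "closedin (zariski_topology R) (basic_open R e)"
  unfolding closedin_def topspace_zariski basic_open_compl[OF assms, symmetric]
  using openin_basic_open[of "\<one> \<ominus> e"] ring_idempotentsD(1)[OF assms]
  by (auto simp: basic_open_def)

text \<open>The inclusion puts the idempotent \<open>e \<otimes> (\<one> \<ominus> f)\<close> into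
  every prime, so it vanishes.\<close>

lemma basic_open_subset_imp:
  assumes e: "e \<in> ring_idempotents R" and f: "f \<in> ring_idempotents R"
    and "basic_open R e \<subseteq> basic_open R f"
  shows "e \<otimes> f = e"
proof -
  note carr = e[THEN ring_idempotentsD(1)] f[THEN ring_idempotentsD(1)]
  have "e \<otimes> (\<one> \<ominus> f) = \<zero>"
  proof (rule idempotent_eq_zero)
    show "e \<otimes> (\<one> \<ominus> f) \<in> ring_idempotents R"
      by (intro idempotent_mult e idempotent_compl f)
    fix p assume p: "primeideal p R"
    interpret p: primeideal p R by fact
    show "e \<otimes> (\<one> \<ominus> f) \<in> p"
    proof (cases "e \<in> p")
      case True then show ?thesis using carr by (intro p.I_r_closed) auto
    next
      case False
      then have "f \<notin> p" using assms(3) p by (auto simp: basic_open_def prime_spectrum_def)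
      then show ?thesis using idempotent_notin_primeideal_iff[OF p f] carr by (intro p.I_l_closed) auto
    qed
  qed
  moreover have "e \<otimes> (\<one> \<ominus> f) = e \<ominus> e \<otimes> f" using carr by algebra
  ultimately show ?thesis using carr by (simp add: r_right_minus_eq)
qed

lemma basic_open_inj_on: "inj_on (basic_open R) (ring_idempotents R)"
proof (rule inj_onI)
  fix e f assume ef: "e \<in> ring_idempotents R" "f \<in> ring_idempotents R" "basic_open R e = basic_open R f"
  then have "e \<otimes> f = e" "f \<otimes> e = f" by (simp_all add: basic_open_subset_imp)
  then show "e = f" using ef m_comm ring_idempotentsD(1) by metis
qed

text \<open>A prime containing the \<open>n\<close>-th powers of \<open>a\<close> and
  \<open>b\<close> would contain both elements and hence 1, so the two powers generate the unit
  ideal.\<close>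

lemma power_unit_ideal:
  assumes ab: "a \<in> carrier R" "b \<in> carrier R" "a \<oplus> b = \<one>"
  obtains x y where "x \<in> carrier R" "y \<in> carrier R" "x \<otimes> a [^] (n::nat) \<oplus> y \<otimes> b [^] n = \<one>"
proof -
  let ?J = "set_add R (PIdl (a [^] n)) (PIdl (b [^] n))"
  have ideals: "ideal (PIdl (a [^] n)) R" "ideal (PIdl (b [^] n)) R" 
    using ab by (auto intro: cgenideal_ideal)
  note J = add_ideals[OF ideals]
  have pow: "c \<in> p" if "primeideal p R" "c \<in> carrier R" "c [^] n \<in> p" for c p
  proof -
    interpret primeideal p R by fact
    from that(3) show ?thesis
    proof (induction n)
      case 0 then show ?case using one_notin by simp
    next
      case (Suc n) then show ?case using I_prime[of "c [^] n" c] that(2) by auto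
    qed
  qed
  have "\<one> \<in> ?J"
  proof (rule ccontr)
    assume "\<one> \<notin> ?J"
    then obtain p where p: "primeideal p R" "?J \<subseteq> p"
      using exists_primeideal_superset[OF J] by metis
    interpret p: primeideal p R by fact
    have "a [^] n \<in> p" "b [^] n \<in> p"
      using subset_set_add[OF ideals] cgenideal_self ab(1,2) p(2) nat_pow_closed by blast+
    then have "a \<in> p" "b \<in> p" using p pow ab by blast+
    then show False using ab(3) p.a_closed p.one_notin by metis
  qed
  then show thesis using that unfolding set_add_iff cgenideal_def by force
qed

text \<open>The clopen set and its complement yield \<open>a\<close> and \<open>b\<close> with sum 1
  and nilpotent product. Replacing them by suitable multiples of high powers makes the product zero
  while the sum stays 1, and the multiple of the power of \<open>a\<close> is then the
  idempotent.\<close>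

lemma clopen_imp_basic_open:
  assumes U: "openin (zariski_topology R) U" "closedin (zariski_topology R) U"
  obtains e where "e \<in> ring_idempotents R" "U = basic_open R e"
proof -
  obtain E where E: "E \<subseteq> carrier R" "U = prime_spectrum R - {p \<in> prime_spectrum R. E \<subseteq> p}"
    using U(1) unfolding openin_zariski by blast
  obtain F where F: "F \<subseteq> carrier R"
    "prime_spectrum R - U = prime_spectrum R - {p \<in> prime_spectrum R. F \<subseteq> p}"
    using U(2) unfolding closedin_def topspace_zariski openin_zariski by blast
  \<comment> \<open>\<open>U\<close> is both the complement of the zero set of \<open>E\<close> and
    the zero set of \<open>F\<close>; in particular no prime contains \<open>E\<close> and
    \<open>F\<close> together.\<close>
  have U_iff: "p \<in> U \<longleftrightarrow> \<not> E \<subseteq> p" "p \<in> U \<longleftrightarrow> F \<subseteq> p" if "primeideal p R" for p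
  proof -
    have p: "p \<in> prime_spectrum R" using that by (simp add: prime_spectrum_def)
    then show "p \<in> U \<longleftrightarrow> \<not> E \<subseteq> p" unfolding E(2) by blast
    have "p \<in> prime_spectrum R - U \<longleftrightarrow> \<not> F \<subseteq> p" using p unfolding F(2) by blast
    then show "p \<in> U \<longleftrightarrow> F \<subseteq> p" using p by blast
  qed
  note ideals = genideal_ideal[OF E(1)] genideal_ideal[OF F(1)]
  interpret I: ideal "Idl E" R by (rule ideals(1))
  interpret J: ideal "Idl F" R by (rule ideals(2))
  have "\<one> \<in> set_add R (Idl E) (Idl F)"
  proof (rule ccontr)
    assume "\<one> \<notin> set_add R (Idl E) (Idl F)"
    then obtain p where p: "primeideal p R" "set_add R (Idl E) (Idl F) \<subseteq> p"
      using exists_primeideal_superset[OF add_ideals[OF ideals]] by metis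
    have "E \<subseteq> p" "F \<subseteq> p"
      using subset_set_add[OF ideals] p(2) genideal_self[OF E(1)] genideal_self[OF F(1)] by blast+
    then show False using p U_iff by blast
  qed
  then obtain a b where a: "a \<in> Idl E" and b: "b \<in> Idl F" and ab1: "a \<oplus> b = \<one>"
    unfolding set_add_iff by metis
  note carr = I.Icarr[OF a] J.Icarr[OF b]
  have aU: "a \<notin> p \<longleftrightarrow> p \<in> U" and bU: "b \<in> p \<longleftrightarrow> p \<in> U" if p: "primeideal p R" for p
  proof -
    interpret p: primeideal p R by fact
    have "a \<notin> p \<or> b \<notin> p" using ab1 p.a_closed p.one_notin by metis
    moreover have "b \<in> p" if "p \<in> U"
      using that U_iff[OF p] genideal_minimal[OF p.ideal_axioms] b by blast
    moreover have "a \<in> p" if "p \<notin> U"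
      using that U_iff[OF p] genideal_minimal[OF p.ideal_axioms] a by blast
    ultimately show "a \<notin> p \<longleftrightarrow> p \<in> U" "b \<in> p \<longleftrightarrow> p \<in> U" by blast+
  qed
  \<comment> \<open>Primes in \<open>U\<close> contain \<open>b\<close> and all others contain
    \<open>a\<close>, so no prime avoids \<open>a \<otimes> b\<close>; if all its powers were
    nonzero, such a prime would exist.\<close>
  have "\<exists>n::nat. (a \<otimes> b) [^] n = \<zero>"
  proof (rule ccontr)
    assume "\<nexists>n::nat. (a \<otimes> b) [^] n = \<zero>"
    then obtain p where p: "primeideal p R" "a \<otimes> b \<notin> p"
      using exists_primeideal_avoiding_powers[OF zeroideal, of "a \<otimes> b"] carr by auto
    interpret p: primeideal p R by fact
    show False using p(2) aU[OF p(1)] bU[OF p(1)] carr p.I_l_closed p.I_r_closed by blast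
  qed
  then obtain n :: nat where n: "(a \<otimes> b) [^] n = \<zero>" by blast
  obtain x y where xy: "x \<in> carrier R" "y \<in> carrier R" "x \<otimes> a [^] n \<oplus> y \<otimes> b [^] n = \<one>"
    using power_unit_ideal[OF carr ab1] by blast
  define e where "e = x \<otimes> a [^] n"
  have e: "e \<in> carrier R" using carr xy by (simp add: e_def)
  have "(u \<oplus> v) \<ominus> u = v" if "u \<in> carrier R" "v \<in> carrier R" for u v
    using that by algebra
  then have compl: "\<one> \<ominus> e = y \<otimes> b [^] n"
    unfolding e_def xy(3)[symmetric] using xy(1,2) carr by simp
  have "e \<otimes> (\<one> \<ominus> e) = x \<otimes> y \<otimes> (a [^] n \<otimes> b [^] n)"
    unfolding compl unfolding e_def using xy carr nat_pow_closed by (simp add: m_ac)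
  also have "\<dots> = \<zero>" using n carr xy by (simp add: nat_pow_distrib)
  finally have ee: "e \<otimes> (\<one> \<ominus> e) = \<zero>" .
  have "e \<otimes> e = e \<ominus> e \<otimes> (\<one> \<ominus> e)" using e by algebra
  then have idem: "e \<in> ring_idempotents R"
    using e ee by (simp add: ring_idempotents_def minus_eq)
  have "e \<notin> p \<longleftrightarrow> p \<in> U" if p: "primeideal p R" for p
  proof -
    interpret p: primeideal p R by fact
    have pow: "c [^] n \<in> p" if "c \<in> p" for c
    proof (cases n)
      \<comment> \<open>Exponent zero would mean 1 = 0, which the existence of the prime
        \<open>p\<close> rules out.\<close>
      case 0 
      then have "\<one> = \<zero>" using n by simp
      then show ?thesis using p.one_notin p.zero_closed by simp
    qed (use that p.Icarr in \<open>simp add: p.I_l_closed\<close>)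
    show ?thesis
    proof
      assume "e \<notin> p"
      then have "a [^] n \<notin> p" unfolding e_def using xy p.I_l_closed by blast
      then show "p \<in> U" using aU[OF p] pow by blast
    next
      assume "p \<in> U"
      then have "\<one> \<ominus> e \<in> p" unfolding compl using bU[OF p] pow xy p.I_l_closed by blast
      then show "e \<notin> p" using idempotent_notin_primeideal_iff[OF p idem] by blast
    qed
  qed
  moreover have "U \<subseteq> prime_spectrum R" using E(2) by blast
  ultimately have "U = basic_open R e" by (auto simp: basic_open_def prime_spectrum_def)
  with idem show thesis by (rule that)
qed


section \<open>Components and primitive idempotents\<close>

lemma ring_idempotents_subset: "ring_idempotents R \<subseteq> carrier R"
  by (auto simp: ring_idempotents_def)

lemma primitive_idempotents_subset: "{e. primitive_idempotent R e} \<subseteq> carrier R"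
  by (auto simp: primitive_idempotent_def ring_idempotents_def)

lemma primeideal_mult_iff:
  assumes "primeideal p R" "x \<in> carrier R" "y \<in> carrier R"
  shows "x \<otimes> y \<in> p \<longleftrightarrow> x \<in> p \<or> y \<in> p"
proof -
  interpret p: primeideal p R by fact
  show ?thesis
    using p.I_prime[OF assms(2,3)] p.I_l_closed[of y x] p.I_r_closed[of x y] assms(2,3) by blast
qed

text \<open>A separation would cut out a clopen part D(f) of D(e) with \<open>f\<close> below
  \<open>e\<close>. Primitivity makes \<open>f\<close> zero or \<open>e\<close>, so one of the two
  pieces is empty.\<close>

lemma connected_basic_open:
  assumes e: "primitive_idempotent R e"
  shows "connectedin (zariski_topology R) (basic_open R e)"
proof -
  note eD = primitive_idempotentD[OF e]
  let ?X = "zariski_topology R" and ?D = "basic_open R e"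
  note clopen = openin_basic_open[OF eD(2)] closedin_basic_open[OF eD(1)]
  have "False" if E: "openin ?X E1" "openin ?X E2" "?D \<subseteq> E1 \<union> E2" "E1 \<inter> E2 \<inter> ?D = {}"
    "E1 \<inter> ?D \<noteq> {}" "E2 \<inter> ?D \<noteq> {}" for E1 E2
  proof -
    let ?U = "E1 \<inter> ?D"
    \<comment> \<open>As the closed set D(e) without an open set, the piece is closed in the whole
      spectrum and not only in D(e).\<close>
    have "?U = ?D - E2" using E(3,4) by blast
    then have "closedin ?X ?U" using E(2) clopen(2) by auto
    then obtain f where f: "f \<in> ring_idempotents R" "?U = basic_open R f"
      using clopen_imp_basic_open E(1) clopen(1) by (metis openin_Int)
    have "f \<otimes> e = f" using basic_open_subset_imp[OF f(1) eD(1)] f(2) by blast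
    then have "e \<otimes> f = f" using m_comm eD(2) ring_idempotentsD(1)[OF f(1)] by simp
    then consider "f = \<zero>" | "f = e" using eD(5) f(1) by blast
    then show False
    proof cases
      case 1
      then have "basic_open R f = {}"
        by (auto simp: basic_open_def prime_spectrum_def primeideal_def
            intro: additive_subgroup.zero_closed ideal.axioms)
      then show False using f(2) E(5) by blast
    next
      case 2 then show False using f(2) E(4,6) by blast
    qed
  qed
  then show ?thesis
    unfolding connectedin
    by (auto simp: topspace_zariski basic_open_def)
qed

text \<open>D(e) and D(1 - e) are disjoint open sets covering the connected set
  \<open>C\<close>.\<close>

lemma component_idempotent_dichotomy:
  assumes "C \<in> connected_components_of (zariski_topology R)" "e \<in> ring_idempotents R"
  shows "C \<subseteq> basic_open R e \<or> C \<inter> basic_open R e = {}"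
proof -
  note e = ring_idempotentsD(1)[OF assms(2)]
  have "C \<subseteq> basic_open R e \<union> basic_open R (\<one> \<ominus> e)"
    using connected_components_of_subset[OF assms(1)] basic_open_compl[OF assms(2)]
    by (auto simp: topspace_zariski)
  moreover have "basic_open R e \<inter> basic_open R (\<one> \<ominus> e) = {}"
    using basic_open_compl[OF assms(2)] by blast
  ultimately show ?thesis
    using connectedinD[OF connectedin_connected_components_of[OF assms(1)]
        openin_basic_open[OF e] openin_basic_open[of "\<one> \<ominus> e"]] e
    by auto
qed

lemma exists_component:
  assumes "primeideal p R"
  obtains C where "C \<in> connected_components_of (zariski_topology R)" "p \<in> C"
  using assms Union_connected_components_of[of "zariski_topology R"]
  by (auto simp: topspace_zariski prime_spectrum_def)

lemma primitive_basic_open_nonempty: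
  assumes "primitive_idempotent R e"
  shows "basic_open R e \<noteq> {}"
  using idempotent_eq_zero[of e] primitive_idempotentD[OF assms]
  by (auto simp: basic_open_def prime_spectrum_def)

text \<open>The dichotomy puts \<open>C\<close> inside D(e); maximality of a component among
  connected sets gives the reverse inclusion.\<close>

lemma component_eq_basic_open:
  assumes C: "C \<in> connected_components_of (zariski_topology R)"
    and e: "primitive_idempotent R e" and "C \<inter> basic_open R e \<noteq> {}"
  shows "C = basic_open R e"
  using component_idempotent_dichotomy[OF C primitive_idempotentD(1)[OF e]] assms(3)
    connected_components_of_maximal[OF C connected_basic_open[OF e]]
  by (auto simp: disjnt_def)

lemma basic_open_primitive_in_components:
  assumes e: "primitive_idempotent R e"
  shows "basic_open R e \<in> connected_components_of (zariski_topology R)"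
proof -
  obtain p where p: "p \<in> basic_open R e" using primitive_basic_open_nonempty[OF e] by blast
  then obtain C where "C \<in> connected_components_of (zariski_topology R)" "p \<in> C"
    using exists_component by (auto simp: basic_open_def prime_spectrum_def)
  then show ?thesis using component_eq_basic_open[OF _ e] p by blast
qed

text \<open>D(e) is the union of the components inside it and determines \<open>e\<close>, so
  idempotents inject into the sets of components.\<close>

lemma finite_idempotents_if_finite_components:
  assumes "finite (connected_components_of (zariski_topology R))"
  shows "finite (ring_idempotents R)"
proof (rule inj_on_finite)
  let ?K = "connected_components_of (zariski_topology R)"
  let ?g = "\<lambda>e. {C \<in> ?K. C \<subseteq> basic_open R e}"
  show "finite (Pow ?K)" using assms by simp
  show "?g ` ring_idempotents R \<subseteq> Pow ?K" by blast
  have "basic_open R e = \<Union>(?g e)" if "e \<in> ring_idempotents R" for e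
  proof (intro subset_antisym subsetI)
    fix p assume p: "p \<in> basic_open R e"
    then obtain C where "C \<in> ?K" "p \<in> C"
      using exists_component by (auto simp: basic_open_def prime_spectrum_def)
    then show "p \<in> \<Union>(?g e)" using component_idempotent_dichotomy that p by blast
  qed blast
  then show "inj_on ?g (ring_idempotents R)"
    using basic_open_inj_on by (metis (no_types, lifting) inj_on_def)
qed

text \<open>Among the idempotents outside \<open>p\<close>, one with the fewest idempotents below it
  is primitive; counting replaces a descent along the order on idempotents.\<close>

lemma exists_primitive_notin:
  assumes fin: "finite (ring_idempotents R)" and p: "primeideal p R"
  obtains e where "primitive_idempotent R e" "e \<notin> p"
proof -
  interpret p: primeideal p R by fact
  let ?below = "\<lambda>f. {g \<in> ring_idempotents R. f \<otimes> g = g}"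
  have "\<one> \<in> ring_idempotents R \<and> \<one> \<notin> p"
    using p.one_notin by (simp add: ring_idempotents_def)
  then obtain f where f: "f \<in> ring_idempotents R" "f \<notin> p"
    and min: "\<And>g. g \<in> ring_idempotents R \<Longrightarrow> g \<notin> p \<Longrightarrow> card (?below f) \<le> card (?below g)"
    using ex_has_least_nat[of "\<lambda>f. f \<in> ring_idempotents R \<and> f \<notin> p" \<one> "\<lambda>f. card (?below f)"]
    by blast
  have eq: "g = f" if g: "g \<in> ring_idempotents R" "g \<notin> p" "f \<otimes> g = g" for g
  proof -
    note carr = ring_idempotentsD(1)[OF f(1)] ring_idempotentsD(1)[OF g(1)]
    \<comment> \<open>By minimality of the count this inclusion is an equality, so \<open>f\<close>
      is below \<open>g\<close> as well.\<close>
    have "?below g \<subseteq> ?below f"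
    proof
      fix h assume h: "h \<in> ?below g"
      then have "f \<otimes> h = f \<otimes> (g \<otimes> h)" by simp
      also have "\<dots> = h"
        using h carr g(3) ring_idempotents_subset m_assoc[of f g h] by auto
      finally show "h \<in> ?below f" using h by simp
    qed
    then have "?below g = ?below f"
      using min[OF g(1,2)] fin by (intro card_seteq) auto
    moreover have "f \<in> ?below f" using f(1) ring_idempotentsD(2) by auto
    ultimately have "g \<otimes> f = f" by blast
    then show ?thesis using g(3) carr by (simp add: m_comm)
  qed
  have "primitive_idempotent R f"
    unfolding primitive_idempotent_def
  proof (intro conjI ballI impI)
    show "f \<noteq> \<zero>" using f(2) p.zero_closed by blast
    fix g assume g: "g \<in> ring_idempotents R" "g \<noteq> \<zero>" "f \<otimes> g = g"
    note carr = ring_idempotentsD(1)[OF f(1)] ring_idempotentsD(1)[OF g(1)]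
    show "f = g"
    proof (cases "g \<in> p")
      case False then show ?thesis using eq g by blast
    next
      case True
      \<comment> \<open>When \<open>g\<close> lies in \<open>p\<close>, the rest of \<open>f\<close>
        is still outside \<open>p\<close> and hence equals \<open>f\<close>. Then
        \<open>f \<otimes> g\<close> is zero although it equals the nonzero
        \<open>g\<close>.\<close>
      let ?h = "f \<otimes> (\<one> \<ominus> g)"
      have h: "?h \<in> ring_idempotents R" using f(1) g(1) idempotent_mult idempotent_compl by blast
      moreover have "?h \<notin> p"
        using True idempotent_notin_primeideal_iff[OF p g(1)] f(2) carr
          idempotent_notin_primeideal_iff[OF p idempotent_compl(1)[OF g(1)]]
        by (metis idempotent_compl(1) g(1) minus_closed one_closed primeideal_mult_iff[OF p])
      moreover have "f \<otimes> ?h = ?h"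
        using carr ring_idempotentsD(2)[OF f(1)] by (simp add: m_assoc[symmetric])
      ultimately have "?h = f" using eq by blast
      then have "f \<otimes> g = (f \<otimes> (\<one> \<ominus> g)) \<otimes> g" by simp
      also have "\<dots> = \<zero>" using carr idempotent_compl(3)[OF g(1)] by (simp add: m_assoc)
      finally show ?thesis using g by simp
    qed
  qed (use f in auto)
  then show thesis using f(2) that by blast
qed

section \<open>Generating the unit ideal by primitive idempotents\<close>

lemma Idl_eq_carrier_iff:
  assumes "S \<subseteq> carrier R"
  shows "Idl S = carrier R \<longleftrightarrow> (\<nexists>p. primeideal p R \<and> S \<subseteq> p)"
proof
  assume *: "Idl S = carrier R"
  show "\<nexists>p. primeideal p R \<and> S \<subseteq> p"
  proof
    assume "\<exists>p. primeideal p R \<and> S \<subseteq> p"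
    then obtain p where p: "primeideal p R" "S \<subseteq> p" by blast
    then show False
      using genideal_minimal[OF primeideal.axioms(1)[OF p(1)] p(2)] primeideal.one_notin[OF p(1)] * by blast
  qed
next
  assume *: "\<nexists>p. primeideal p R \<and> S \<subseteq> p"
  have "\<one> \<in> Idl S"
  proof (rule ccontr)
    assume "\<one> \<notin> Idl S"
    then obtain p where "primeideal p R" "Idl S \<subseteq> p"
      by (rule exists_primeideal_superset[OF genideal_ideal[OF assms]])
    then show False using * genideal_self[OF assms] by blast
  qed
  then show "Idl S = carrier R"
    using ideal.one_imp_carrier[OF genideal_ideal[OF assms]] by blast
qed

lemma primitive_generate_if_finite_idempotents:
  assumes "finite (ring_idempotents R)"
  shows "Idl {e. primitive_idempotent R e} = carrier R"
  using exists_primitive_notin[OF assms] Idl_eq_carrier_iff[OF primitive_idempotents_subset]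
  by blast

text \<open>Every component contains a prime, some primitive \<open>e\<close> lies outside that
  prime, and the component then meets D(e) and equals it.\<close>

lemma components_eq_if_primitive_generate:
  assumes "Idl {e. primitive_idempotent R e} = carrier R"
  shows "connected_components_of (zariski_topology R) = {basic_open R e | e. primitive_idempotent R e}"
proof (intro subset_antisym subsetI)
  fix C assume C: "C \<in> connected_components_of (zariski_topology R)"
  then obtain p where p: "p \<in> C" "p \<in> prime_spectrum R"
    using nonempty_connected_components_of connected_components_of_subset topspace_zariski by blast
  moreover from p(2) have "\<not> {e. primitive_idempotent R e} \<subseteq> p"
    using assms Idl_eq_carrier_iff[OF primitive_idempotents_subset]
    by (auto simp: prime_spectrum_def)
  ultimately obtain e where "primitive_idempotent R e" "p \<in> basic_open R e"
    by (auto simp: basic_open_def)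
  then show "C \<in> {basic_open R e | e. primitive_idempotent R e}"
    using component_eq_basic_open[OF C] p(1) by blast
qed (use basic_open_primitive_in_components in blast)

text \<open>A prime containing all primitive idempotents would lie in no D(e) with \<open>e\<close>
  primitive, hence in no component.\<close>

lemma primitive_generate_if_components_eq:
  assumes "connected_components_of (zariski_topology R) = {basic_open R e | e. primitive_idempotent R e}"
  shows "Idl {e. primitive_idempotent R e} = carrier R"
proof (subst Idl_eq_carrier_iff)
  show "\<nexists>p. primeideal p R \<and> {e. primitive_idempotent R e} \<subseteq> p"
  proof
    assume "\<exists>p. primeideal p R \<and> {e. primitive_idempotent R e} \<subseteq> p"
    then obtain p where p: "primeideal p R" "{e. primitive_idempotent R e} \<subseteq> p" by blast
    then obtain C where "C \<in> connected_components_of (zariski_topology R)" "p \<in> C"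
      using exists_component by blast
    then show False using p assms by (auto simp: basic_open_def)
  qed
qed (rule primitive_idempotents_subset)

text \<open>The product lies below both idempotents, so if it were nonzero it would equal each of
  them.\<close>

lemma primitive_orthogonal:
  assumes e: "primitive_idempotent R e" and f: "primitive_idempotent R f" and "e \<noteq> f"
  shows "e \<otimes> f = \<zero>"
proof (rule ccontr)
  assume ne: "e \<otimes> f \<noteq> \<zero>"
  note eD = primitive_idempotentD[OF e] and fD = primitive_idempotentD[OF f]
  have idem: "e \<otimes> f \<in> ring_idempotents R" using idempotent_mult eD fD by blast
  have "e \<otimes> (e \<otimes> f) = e \<otimes> f" using eD fD by (simp add: m_assoc[symmetric])
  moreover have "f \<otimes> (e \<otimes> f) = e \<otimes> f" using eD fD by (simp add: m_lcomm)
  ultimately show False using eD(5) fD(5) idem ne \<open>e \<noteq> f\<close> by metis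
qed

text \<open>The elements generated by finite subsets of \<open>S\<close> form an ideal, because two
  finite subsets have a finite union; this ideal contains \<open>S\<close>.\<close>

lemma in_finitely_generated_Idl:
  assumes S: "S \<subseteq> carrier R" and x: "x \<in> Idl S"
  obtains T where "finite T" "T \<subseteq> S" "x \<in> Idl T"
proof -
  let ?J = "{x. \<exists>T. finite T \<and> T \<subseteq> S \<and> x \<in> Idl T}"
  have Idl: "ideal (Idl T) R" if "T \<subseteq> S" for T using genideal_ideal that S by blast
  have carr: "x \<in> carrier R" if "x \<in> Idl T" "T \<subseteq> S" for x T
    using that ideal.Icarr[OF Idl] by blast
  have "ideal ?J R"
  proof (rule idealI)
    show "subgroup ?J (add_monoid R)"
    proof (rule add.subgroupI)
      show "?J \<subseteq> carrier R" using carr by blast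
      have "\<zero> \<in> Idl {}" using Idl[of "{}"] additive_subgroup.zero_closed ideal.axioms(1) by blast
      then show "?J \<noteq> {}" by blast
      show "\<ominus> x \<in> ?J" if "x \<in> ?J" for x
        using that additive_subgroup.a_inv_closed[OF ideal.axioms(1)[OF Idl]] by blast
      fix x y assume "x \<in> ?J" "y \<in> ?J"
      then obtain T U where TU: "finite T" "T \<subseteq> S" "x \<in> Idl T" "finite U" "U \<subseteq> S" "y \<in> Idl U"
        by blast
      then have "Idl T \<subseteq> Idl (T \<union> U)" "Idl U \<subseteq> Idl (T \<union> U)"
        using S by (intro subset_Idl_subset; blast)+
      then have "x \<oplus> y \<in> Idl (T \<union> U)"
        using TU additive_subgroup.a_closed[OF ideal.axioms(1)[OF Idl[of "T \<union> U"]]] by blast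
      then show "x \<oplus> y \<in> ?J" using TU by (blast intro: finite_UnI)
    qed
    fix x r assume "x \<in> ?J" and r: "r \<in> carrier R"
    then obtain T where T: "finite T" "T \<subseteq> S" "x \<in> Idl T" by blast
    show "r \<otimes> x \<in> ?J" using ideal.I_l_closed[OF Idl[OF T(2)] T(3) r] T by blast
    show "x \<otimes> r \<in> ?J" using ideal.I_r_closed[OF Idl[OF T(2)] T(3) r] T by blast
  qed (rule ring_axioms)
  moreover have "S \<subseteq> ?J"
  proof
    fix s assume "s \<in> S"
    then have "s \<in> Idl {s}" using S genideal_self' by blast
    then show "s \<in> ?J" using \<open>s \<in> S\<close> by blast
  qed
  ultimately have "x \<in> ?J" using genideal_minimal[of ?J S] x by (meson subsetD)
  then show thesis using that by blast
qed

text \<open>Finitely many members of \<open>S\<close> already generate 1. An idempotent multiplies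
  each of them to zero or to itself, and the resulting subset of \<open>T\<close> determines it: if
  two idempotents give the same subset, all of \<open>T\<close> kills their difference.\<close>

lemma finite_idempotents_if_primitive_generate:
  assumes S: "\<And>e. e \<in> S \<Longrightarrow> primitive_idempotent R e" and gen: "Idl S = carrier R"
  shows "finite (ring_idempotents R)"
proof -
  have SR: "S \<subseteq> carrier R" using S primitive_idempotents_subset by blast
  obtain T where T: "finite T" "T \<subseteq> S" "\<one> \<in> Idl T"
    using in_finitely_generated_Idl[OF SR, of \<one>] gen by auto
  have TR: "T \<subseteq> carrier R" using T(2) SR by blast
  have "inj_on (\<lambda>e. {t \<in> T. t \<otimes> e = t}) (ring_idempotents R)"
  proof (rule inj_onI)
    fix e f assume e: "e \<in> ring_idempotents R" and f: "f \<in> ring_idempotents R"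
      and eq: "{t \<in> T. t \<otimes> e = t} = {t \<in> T. t \<otimes> f = t}"
    note carr = e[THEN ring_idempotentsD(1)] f[THEN ring_idempotentsD(1)]
    have "t \<otimes> (e \<ominus> f) = \<zero>" if t: "t \<in> T" for t
    proof -
      have tp: "primitive_idempotent R t" using t T(2) S by blast
      note tD = primitive_idempotentD[OF tp]
      have *: "t \<otimes> g = \<zero> \<or> t \<otimes> g = t" if "g \<in> ring_idempotents R" for g
        using tD(5)[OF idempotent_mult[OF tD(1) that]] tD(2,3) ring_idempotentsD(1)[OF that]
        by (simp add: m_assoc[symmetric])
      have "t \<otimes> e = t \<otimes> f" 
      proof -
        have "t \<otimes> e = t \<longleftrightarrow> t \<otimes> f = t" using eq t by blast
        then show ?thesis using *[OF e] *[OF f] by auto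
      qed
      moreover have "t \<otimes> (e \<ominus> f) = t \<otimes> e \<ominus> t \<otimes> f" using carr tD(2) by algebra
      ultimately show ?thesis using carr tD(2) by simp
    qed
    then have "\<one> \<otimes> (e \<ominus> f) = \<zero>"
      using annihilates_Idl[OF TR, of "e \<ominus> f" \<one>] T(3) carr by simp
    then show "e = f" using carr by simp
  qed
  then show ?thesis
    by (rule inj_on_finite[where B = "Pow T"]) (use T(1) in auto)
qed

text \<open>Finitely many elements of a regular ideal share an idempotent \<open>f\<close> of that
  ideal that acts on them as the identity. Elements fixed by some such \<open>f\<close> form an
  ideal containing \<open>S\<close>, since any two idempotents have a join.\<close>

lemma idempotent_local_unit:
  assumes S: "S \<subseteq> ring_idempotents R" and "finite T" "T \<subseteq> Idl S"
  obtains f where "f \<in> ring_idempotents R" "f \<in> Idl S" "\<And>t. t \<in> T \<Longrightarrow> t \<otimes> (\<one> \<ominus> f) = \<zero>"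
proof -
  have SR: "S \<subseteq> carrier R" using S ring_idempotents_subset by blast
  interpret I: ideal "Idl S" R by (rule genideal_ideal[OF SR])
  define F where "F = ring_idempotents R \<inter> Idl S"
  have FR: "f \<in> carrier R" if "f \<in> F" for f using that by (auto simp: F_def ring_idempotents_def)
  have zero: "\<zero> \<in> F" by (simp add: F_def ring_idempotents_def)
  have join: "\<exists>h\<in>F. \<one> \<ominus> h = (\<one> \<ominus> f) \<otimes> (\<one> \<ominus> g)" if fg: "f \<in> F" "g \<in> F" for f g
  proof
    \<comment> \<open>The Boolean join of \<open>f\<close> and \<open>g\<close>, chosen so that its
      complement is the product of their complements.\<close>
    let ?h = "f \<oplus> g \<otimes> (\<one> \<ominus> f)"
    note carr = fg[THEN FR]
    show eq: "\<one> \<ominus> ?h = (\<one> \<ominus> f) \<otimes> (\<one> \<ominus> g)" using carr by algebra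
    have "\<one> \<ominus> (\<one> \<ominus> ?h) \<in> ring_idempotents R"
      using fg unfolding eq by (intro idempotent_compl(1) idempotent_mult) (auto simp: F_def)
    moreover have "\<one> \<ominus> (\<one> \<ominus> ?h) = ?h" using carr by algebra
    moreover have "?h \<in> Idl S" using fg carr by (simp add: F_def I.I_r_closed)
    ultimately show "?h \<in> F" by (simp add: F_def)
  qed
  let ?J = "{x \<in> carrier R. \<exists>f\<in>F. x \<otimes> (\<one> \<ominus> f) = \<zero>}"
  have J: "ideal ?J R"
  proof (rule idealI)
    show "subgroup ?J (add_monoid R)"
    proof (rule add.subgroupI)
      show "?J \<noteq> {}" using zero by force
      show "\<ominus> x \<in> ?J" if "x \<in> ?J" for x
        using that FR by (auto simp: l_minus)
      fix x y assume "x \<in> ?J" "y \<in> ?J"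
      then obtain f g where x: "x \<in> carrier R" "f \<in> F" "x \<otimes> (\<one> \<ominus> f) = \<zero>"
        and y: "y \<in> carrier R" "g \<in> F" "y \<otimes> (\<one> \<ominus> g) = \<zero>" by blast
      obtain h where h: "h \<in> F" "\<one> \<ominus> h = (\<one> \<ominus> f) \<otimes> (\<one> \<ominus> g)" using join x y by blast
      note carr = x(1) y(1) x(2)[THEN FR] y(2)[THEN FR]
      have "(x \<oplus> y) \<otimes> (\<one> \<ominus> h) = (x \<otimes> (\<one> \<ominus> f)) \<otimes> (\<one> \<ominus> g) \<oplus> (y \<otimes> (\<one> \<ominus> g)) \<otimes> (\<one> \<ominus> f)"
        unfolding h(2) using carr by algebra
      also have "\<dots> = \<zero>" using carr by (simp add: x(3) y(3))
      finally show "x \<oplus> y \<in> ?J" using h(1) carr by auto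
    qed auto
  next
    fix x r assume "x \<in> ?J" and r: "r \<in> carrier R"
    then obtain f where x: "x \<in> carrier R" "f \<in> F" "x \<otimes> (\<one> \<ominus> f) = \<zero>" by blast
    then have "(r \<otimes> x) \<otimes> (\<one> \<ominus> f) = \<zero>" using r FR by (simp add: m_assoc)
    then show "r \<otimes> x \<in> ?J" "x \<otimes> r \<in> ?J" using x r by (auto simp: m_comm)
  qed (rule ring_axioms)
  have "S \<subseteq> ?J"
  proof
    fix s assume "s \<in> S"
    then have "s \<in> F" "s \<in> carrier R" "s \<otimes> (\<one> \<ominus> s) = \<zero>"
      using S SR genideal_self[OF SR] idempotent_compl by (auto simp: F_def)
    then show "s \<in> ?J" by blast
  qed
  then have "Idl S \<subseteq> ?J" using genideal_minimal[OF J] by blast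
  then have TJ: "T \<subseteq> ?J" using assms(3) by blast
  with \<open>finite T\<close> have "\<exists>f\<in>F. \<forall>t\<in>T. t \<otimes> (\<one> \<ominus> f) = \<zero>"
  proof induction
    case empty then show ?case using zero by blast
  next
    case (insert x T)
    then obtain f g where f: "f \<in> F" "\<forall>t\<in>T. t \<otimes> (\<one> \<ominus> f) = \<zero>"
      and g: "g \<in> F" "x \<in> carrier R" "x \<otimes> (\<one> \<ominus> g) = \<zero>" by blast
    obtain h where h: "h \<in> F" "\<one> \<ominus> h = (\<one> \<ominus> f) \<otimes> (\<one> \<ominus> g)" using join f g by blast
    note carr = f(1)[THEN FR] g(1)[THEN FR]
    have "t \<otimes> (\<one> \<ominus> h) = \<zero>" if "t \<in> insert x T" for t
    proof (cases "t = x")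
      case True
      have "x \<otimes> ((\<one> \<ominus> f) \<otimes> (\<one> \<ominus> g)) = (x \<otimes> (\<one> \<ominus> g)) \<otimes> (\<one> \<ominus> f)" using carr g(2) by algebra
      then show ?thesis using True h(2) g(3) carr by simp
    next
      case False
      then have "t \<in> carrier R" "t \<otimes> (\<one> \<ominus> f) = \<zero>" using that insert.prems f(2) by auto
      then show ?thesis using h(2) carr by (simp add: m_assoc[symmetric])
    qed
    then show ?case using h(1) by blast
  qed
  then show thesis using that by (auto simp: F_def)
qed

text \<open>If a prime \<open>p\<close> contained all primitive idempotents, its idempotents would
  generate a max-regular ideal, and finite generation of that ideal would produce a primitive
  idempotent outside \<open>p\<close>.\<close>

lemma primitive_generate_if_max_regular_fg:
  assumes fg: "\<And>M. max_regular_ideal R M \<Longrightarrow> finitely_generated_ideal R M"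
  shows "Idl {e. primitive_idempotent R e} = carrier R"
proof (rule ccontr)
  assume "Idl {e. primitive_idempotent R e} \<noteq> carrier R"
  then obtain p where p: "primeideal p R" and prim: "{e. primitive_idempotent R e} \<subseteq> p"
    using Idl_eq_carrier_iff[OF primitive_idempotents_subset] by blast
  interpret p: primeideal p R by (rule p)
  define S where "S = p \<inter> ring_idempotents R"
  have SR: "S \<subseteq> carrier R" by (auto simp: S_def ring_idempotents_def)
  have Sidem: "S \<subseteq> ring_idempotents R" by (auto simp: S_def)
  interpret M: ideal "Idl S" R by (rule genideal_ideal[OF SR])
  have Mp: "Idl S \<subseteq> p" using genideal_minimal[OF p.ideal_axioms] by (auto simp: S_def)
  \<comment> \<open>An idempotent generator of \<open>J\<close> outside \<open>p\<close> has its
    complement in \<open>S\<close>, so \<open>J\<close> would contain 1; hence all generators of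
    \<open>J\<close> lie in \<open>S\<close>.\<close>
  have max: "J = Idl S" if J: "regular_ideal R J" "J \<noteq> carrier R" "Idl S \<subseteq> J" for J
  proof -
    obtain U where U: "U \<subseteq> ring_idempotents R" "J = Idl U"
      using J(1) by (auto simp: regular_ideal_def)
    have UR: "U \<subseteq> carrier R" using U(1) ring_idempotents_subset by blast
    interpret J: ideal J R unfolding U(2) by (rule genideal_ideal[OF UR])
    have "U \<subseteq> p"
    proof (rule ccontr)
      assume "\<not> U \<subseteq> p"
      then obtain e where e: "e \<in> U" "e \<notin> p" by blast
      then have idem: "e \<in> ring_idempotents R" using U(1) by blast
      then have "\<one> \<ominus> e \<in> S"
        using e(2) idempotent_notin_primeideal_iff[OF p] idempotent_compl(1) by (simp add: S_def)
      then have "\<one> \<ominus> e \<in> J" using genideal_self[OF SR] J(3) by blast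
      moreover have "e \<in> J" using genideal_self[OF UR] U(2) e(1) by blast
      ultimately have "e \<oplus> (\<one> \<ominus> e) \<in> J" by (rule J.a_closed[rotated])
      moreover have "e \<oplus> (\<one> \<ominus> e) = \<one>" using ring_idempotentsD(1)[OF idem] by algebra
      ultimately show False using J(2) J.one_imp_carrier by simp
    qed
    then have "U \<subseteq> S" using U(1) by (auto simp: S_def)
    then have "J \<subseteq> Idl S" using subset_Idl_subset[OF SR] U(2) by blast
    then show ?thesis using J(3) by blast
  qed
  have reg: "regular_ideal R (Idl S)" using Sidem by (auto simp: regular_ideal_def)
  have one: "\<one> \<notin> Idl S" using Mp p.one_notin by blast
  then have "max_regular_ideal R (Idl S)"
    using reg max unfolding max_regular_ideal_def by auto
  then obtain T where T: "finite T" "T \<subseteq> carrier R" "Idl S = Idl T"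
    using fg unfolding finitely_generated_ideal_def by blast
  \<comment> \<open>\<open>f\<close> acts as the identity on the finitely many generators and
    therefore on the whole ideal \<open>Idl S\<close>.\<close>
  obtain f where f: "f \<in> ring_idempotents R" "f \<in> Idl S" "\<And>t. t \<in> T \<Longrightarrow> t \<otimes> (\<one> \<ominus> f) = \<zero>"
    using idempotent_local_unit[OF Sidem T(1)] genideal_self[OF T(2)] T(3) by metis
  note fR = ring_idempotentsD(1)[OF f(1)]
  have unit: "x \<otimes> (\<one> \<ominus> f) = \<zero>" if "x \<in> Idl S" for x
    using annihilates_Idl[OF T(2), of "\<one> \<ominus> f" x] f(3) fR T(3) that by simp
  have "primitive_idempotent R (\<one> \<ominus> f)"
    unfolding primitive_idempotent_def
  proof (intro conjI ballI impI)
    show "\<one> \<ominus> f \<in> ring_idempotents R" using idempotent_compl f(1) by blast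
    show "\<one> \<ominus> f \<noteq> \<zero>" using f(2) one fR by auto
    fix g assume g: "g \<in> ring_idempotents R" "g \<noteq> \<zero>" "(\<one> \<ominus> f) \<otimes> g = g"
    note gR = ring_idempotentsD(1)[OF g(1)]
    \<comment> \<open>A nonzero \<open>g\<close> below 1 - \<open>f\<close> is outside
      \<open>Idl S\<close>, because 1 - \<open>f\<close> fixes \<open>g\<close> but kills that
      ideal. Adjoining \<open>g\<close> thus gives the unit ideal by maximality.\<close>
    let ?J = "Idl (insert g S)"
    have gSR: "insert g S \<subseteq> carrier R" using gR SR by blast
    have "insert g S \<subseteq> ring_idempotents R" using Sidem g(1) by blast
    then have "regular_ideal R ?J" unfolding regular_ideal_def by blast
    moreover have "Idl S \<subseteq> ?J" using subset_Idl_subset[OF gSR] by blast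
    moreover have "g \<in> ?J" using genideal_self[OF gSR] by blast
    moreover have "g \<notin> Idl S"
      using unit[of g] g(2,3) gR fR by (metis m_comm minus_closed one_closed)
    ultimately have J: "?J = carrier R" using max by blast
    \<comment> \<open>The difference between 1 - \<open>f\<close> and \<open>g\<close> is this
      product; it kills generators of the unit ideal and so vanishes.\<close>
    have "s \<otimes> ((\<one> \<ominus> f) \<otimes> (\<one> \<ominus> g)) = \<zero>" if "s \<in> insert g S" for s
    proof (cases "s = g")
      case True
      have "g \<otimes> ((\<one> \<ominus> f) \<otimes> (\<one> \<ominus> g)) = (\<one> \<ominus> f) \<otimes> (g \<otimes> (\<one> \<ominus> g))" using gR fR by (simp add: m_lcomm)
      then show ?thesis using True idempotent_compl(2)[OF g(1)] fR by simp
    next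
      case False
      then have "s \<in> Idl S" "s \<in> carrier R" using that SR genideal_self[OF SR] by auto
      then show ?thesis using unit fR gR by (simp add: m_assoc[symmetric])
    qed
    then have "\<one> \<otimes> ((\<one> \<ominus> f) \<otimes> (\<one> \<ominus> g)) = \<zero>"
      using annihilates_Idl[OF gSR, of "(\<one> \<ominus> f) \<otimes> (\<one> \<ominus> g)" \<one>] J fR gR by simp
    moreover have "(\<one> \<ominus> f) \<otimes> (\<one> \<ominus> g) = (\<one> \<ominus> f) \<ominus> (\<one> \<ominus> f) \<otimes> g" using fR gR by algebra
    ultimately show "\<one> \<ominus> f = g" using fR gR unfolding g(3) by simp
  qed
  then have "\<one> \<ominus> f \<in> p" using prim by blast
  then show False using f(1,2) Mp idempotent_notin_primeideal_iff[OF p] by blast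
qed


section \<open>Product decompositions\<close>

lemma PIdl_compl_eq_annihilator:
  assumes "e \<in> ring_idempotents R"
  shows "PIdl (\<one> \<ominus> e) = {x \<in> carrier R. x \<otimes> e = \<zero>}"
proof
  note e = ring_idempotentsD(1)[OF assms]
  show "PIdl (\<one> \<ominus> e) \<subseteq> {x \<in> carrier R. x \<otimes> e = \<zero>}"
    using cgenideal_minimal[OF ideal_annihilator[OF e], of "\<one> \<ominus> e"] idempotent_compl(3)[OF assms] e
    by simp
  show "{x \<in> carrier R. x \<otimes> e = \<zero>} \<subseteq> PIdl (\<one> \<ominus> e)"
  proof
    fix x assume "x \<in> {x \<in> carrier R. x \<otimes> e = \<zero>}"
    then have x: "x \<in> carrier R" "x \<otimes> e = \<zero>" by simp_all
    have "x \<otimes> (\<one> \<ominus> e) = x \<ominus> x \<otimes> e" using x(1) e by algebra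
    then have "x = x \<otimes> (\<one> \<ominus> e)" using x by (simp add: minus_eq)
    then show "x \<in> PIdl (\<one> \<ominus> e)" using x unfolding cgenideal_def by blast
  qed
qed

text \<open>Since the ideal generated by 1 - \<open>e\<close> is the annihilator of
  \<open>e\<close>, multiplication by \<open>e\<close> replaces computation with cosets by
  computation in \<open>R\<close>.\<close>

lemma coset_compl_eq_iff:
  assumes e: "e \<in> ring_idempotents R" and "x \<in> carrier R" "y \<in> carrier R"
  shows "PIdl (\<one> \<ominus> e) +> x = PIdl (\<one> \<ominus> e) +> y \<longleftrightarrow> x \<otimes> e = y \<otimes> e"
proof -
  note eR = ring_idempotentsD(1)[OF e]
  have "ideal (PIdl (\<one> \<ominus> e)) R" using eR by (intro cgenideal_ideal) simp
  then have "PIdl (\<one> \<ominus> e) +> x = PIdl (\<one> \<ominus> e) +> y \<longleftrightarrow> (x \<ominus> y) \<otimes> e = \<zero>"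
    using quotient_eq_iff_same_a_r_cos[of "PIdl (\<one> \<ominus> e)" x y] assms
    unfolding PIdl_compl_eq_annihilator[OF e] by auto
  also have "(x \<ominus> y) \<otimes> e = x \<otimes> e \<ominus> y \<otimes> e" using assms(2,3) eR by algebra
  finally show ?thesis using assms(2,3) eR by simp
qed

lemma cring_Quot_compl:
  assumes "e \<in> ring_idempotents R"
  shows "cring (R Quot PIdl (\<one> \<ominus> e))"
  using ring_idempotentsD(1)[OF assms]
  by (intro ideal.quotient_is_cring cgenideal_ideal is_cring) simp

lemma rcos_ring_hom_compl:
  assumes "e \<in> ring_idempotents R"
  shows "(+>) (PIdl (\<one> \<ominus> e)) \<in> ring_hom R (R Quot PIdl (\<one> \<ominus> e))"
  using ring_idempotentsD(1)[OF assms]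
  by (intro ideal.rcos_ring_hom cgenideal_ideal) simp

lemma Quot_carrierE:
  assumes "c \<in> carrier (R Quot I)"
  obtains x where "x \<in> carrier R" "c = I +> x"
  using assms by (auto simp: FactRing_simps)

text \<open>The Chinese remainder theorem for orthogonal idempotents. The map is injective because
  the difference of two elements with equal images is killed by all \<open>e i\<close>, which
  generate the unit ideal.\<close>

lemma ring_iso_product_Quot:
  fixes e :: "'i \<Rightarrow> 'a"
  assumes fin: "finite I" and idem: "\<And>i. i \<in> I \<Longrightarrow> e i \<in> ring_idempotents R"
    and orth: "\<And>i j. i \<in> I \<Longrightarrow> j \<in> I \<Longrightarrow> i \<noteq> j \<Longrightarrow> e i \<otimes> e j = \<zero>"
    and gen: "Idl (e ` I) = carrier R"
  shows "R \<simeq> product_ring I (\<lambda>i. R Quot PIdl (\<one> \<ominus> e i))"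
proof -
  let ?P = "product_ring I (\<lambda>i. R Quot PIdl (\<one> \<ominus> e i))"
  let ?h = "\<lambda>x. \<lambda>i\<in>I. PIdl (\<one> \<ominus> e i) +> x"
  note eR = ring_idempotentsD(1)[OF idem]
  note hom = rcos_ring_hom_compl[OF idem]
  have "?h \<in> ring_iso R ?P"
  proof (rule ring_iso_memI)
    fix x assume x: "x \<in> carrier R"
    show "?h x \<in> carrier ?P"
      using ring_hom_memE(1)[OF hom x] by (simp add: product_ring_def)
    fix y assume y: "y \<in> carrier R"
    show "?h (x \<otimes> y) = ?h x \<otimes>\<^bsub>?P\<^esub> ?h y" "?h (x \<oplus> y) = ?h x \<oplus>\<^bsub>?P\<^esub> ?h y"
      using ring_hom_memE(2,3)[OF hom x y] by (auto simp: product_ring_def intro!: restrict_ext)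
  next
    show "?h \<one> = \<one>\<^bsub>?P\<^esub>"
      using ring_hom_memE(4)[OF hom] by (auto simp: product_ring_def intro!: restrict_ext)
  next
    show "bij_betw ?h (carrier R) (carrier ?P)"
      unfolding bij_betw_def
    proof
      show "inj_on ?h (carrier R)"
      proof (rule inj_onI)
        fix x y assume xy: "x \<in> carrier R" "y \<in> carrier R" "?h x = ?h y"
        have "e i \<otimes> (x \<ominus> y) = \<zero>" if i: "i \<in> I" for i
        proof -
          have "PIdl (\<one> \<ominus> e i) +> x = PIdl (\<one> \<ominus> e i) +> y"
            using fun_cong[OF xy(3), of i] i by simp
          then have "x \<otimes> e i = y \<otimes> e i" using coset_compl_eq_iff[OF idem[OF i] xy(1,2)] by simp
          moreover have "e i \<otimes> (x \<ominus> y) = x \<otimes> e i \<ominus> y \<otimes> e i" using xy(1,2) eR[OF i] by algebra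
          ultimately show ?thesis using xy(1,2) eR[OF i] by simp
        qed
        then have "\<one> \<otimes> (x \<ominus> y) = \<zero>"
          using annihilates_Idl[of "e ` I" "x \<ominus> y" \<one>] gen eR xy(1,2) by auto
        then show "x = y" using xy(1,2) by simp
      qed
      show "?h ` carrier R = carrier ?P"
      proof
        show "?h ` carrier R \<subseteq> carrier ?P"
          using ring_hom_memE(1)[OF hom] by (auto simp: product_ring_def)
        show "carrier ?P \<subseteq> ?h ` carrier R"
        proof
          fix c assume c: "c \<in> carrier ?P"
          have "\<exists>x\<in>carrier R. c i = PIdl (\<one> \<ominus> e i) +> x" if "i \<in> I" for i
            using c that by (auto simp: product_ring_def PiE_iff elim!: Quot_carrierE)
          then obtain y where y: "\<And>i. i \<in> I \<Longrightarrow> y i \<in> carrier R"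
            "\<And>i. i \<in> I \<Longrightarrow> c i = PIdl (\<one> \<ominus> e i) +> y i"
            by metis
          \<comment> \<open>By orthogonality, multiplying this sum by \<open>e i\<close> leaves only
            the \<open>i\<close>-th summand, so it is a preimage of \<open>c\<close>.\<close>
          let ?x = "\<Oplus>i\<in>I. y i \<otimes> e i"
          have ye: "(\<lambda>i. y i \<otimes> e i) \<in> I \<rightarrow> carrier R" using y(1) eR by auto
          have x: "?x \<in> carrier R" by (rule finsum_closed[OF ye])
          have "c i = PIdl (\<one> \<ominus> e i) +> ?x" if i: "i \<in> I" for i
          proof -
            have "?x \<otimes> e i = (\<Oplus>j\<in>I. y j \<otimes> e j \<otimes> e i)"
              by (rule finsum_ldistr[OF fin eR[OF i] ye])
            also have "\<dots> = (\<Oplus>j\<in>I. if i = j then y j \<otimes> e j else \<zero>)"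
            proof (rule finsum_cong')
              fix j assume j: "j \<in> I"
              show "y j \<otimes> e j \<otimes> e i = (if i = j then y j \<otimes> e j else \<zero>)"
                using y(1)[OF j] eR[OF j] eR[OF i] orth[OF j i] ring_idempotentsD(2)[OF idem[OF i]]
                by (auto simp: m_assoc)
            qed (use ye in auto)
            also have "\<dots> = y i \<otimes> e i"
              using add.finprod_singleton[OF i fin ye] by simp
            finally have "y i \<otimes> e i = ?x \<otimes> e i" ..
            then show ?thesis
              using coset_compl_eq_iff[OF idem[OF i] y(1)[OF i] x] y(2)[OF i] by simp
          qed
          then have "c = ?h ?x"
            using c by (intro ext) (auto simp: product_ring_def PiE_iff extensional_def)
          then show "c \<in> ?h ` carrier R" using x by blast
        qed
      qed
    qed
  qed
  then show ?thesis unfolding is_ring_iso_def by blast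
qed

text \<open>An idempotent coset of \<open>x\<close> makes \<open>x \<otimes> e\<close> an idempotent
  below \<open>e\<close>, even if \<open>x\<close> is not idempotent. Primitivity leaves zero and
  \<open>e\<close>, which represent the cosets of 0 and 1.\<close>

lemma idempotents_Quot_primitive:
  assumes e: "primitive_idempotent R e"
  shows "ring_idempotents (R Quot PIdl (\<one> \<ominus> e))
    \<subseteq> {\<zero>\<^bsub>R Quot PIdl (\<one> \<ominus> e)\<^esub>, \<one>\<^bsub>R Quot PIdl (\<one> \<ominus> e)\<^esub>}"
proof
  let ?I = "PIdl (\<one> \<ominus> e)" and ?Q = "R Quot PIdl (\<one> \<ominus> e)"
  note eD = primitive_idempotentD[OF e]
  have I: "ideal ?I R" using eD(2) by (intro cgenideal_ideal) simp
  have zero: "\<zero>\<^bsub>?Q\<^esub> = ?I +> \<zero>" 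
    using a_coset_add_zero[OF additive_subgroup.a_subset[OF ideal.axioms(1)[OF I]]] by (simp add: FactRing_def)
  fix c assume c: "c \<in> ring_idempotents ?Q"
  then obtain x where x: "x \<in> carrier R" "c = ?I +> x"
    using Quot_carrierE ring_idempotentsD(1) by metis
  have "?I +> (x \<otimes> x) = ?I +> x"
    using ring_idempotentsD(2)[OF c] x ring_hom_memE(2)[OF rcos_ring_hom_compl[OF eD(1)] x(1) x(1)] by simp
  then have xxe: "x \<otimes> x \<otimes> e = x \<otimes> e" using coset_compl_eq_iff[OF eD(1)] x(1) by simp
  have "(x \<otimes> e) \<otimes> (x \<otimes> e) = (x \<otimes> x \<otimes> e) \<otimes> e" using x(1) eD(2) by algebra
  also have "\<dots> = x \<otimes> e" unfolding xxe using x(1) eD(2,3) by (simp add: m_assoc)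
  finally have "x \<otimes> e \<in> ring_idempotents R" using x(1) eD(2) by (simp add: ring_idempotents_def)
  moreover have "e \<otimes> (x \<otimes> e) = x \<otimes> e" using x(1) eD(2,3) m_lcomm[of e x e] by simp
  ultimately have "x \<otimes> e = \<zero> \<otimes> e \<or> x \<otimes> e = \<one> \<otimes> e" using eD(2,5) by auto
  then have "c = ?I +> \<zero> \<or> c = ?I +> \<one>" using coset_compl_eq_iff[OF eD(1)] x by auto
  then show "c \<in> {\<zero>\<^bsub>?Q\<^esub>, \<one>\<^bsub>?Q\<^esub>}" unfolding zero by (auto simp: FactRing_def)
qed

lemma one_neq_zero_Quot_primitive:
  assumes e: "primitive_idempotent R e"
  shows "\<one>\<^bsub>R Quot PIdl (\<one> \<ominus> e)\<^esub> \<noteq> \<zero>\<^bsub>R Quot PIdl (\<one> \<ominus> e)\<^esub>"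
proof -
  let ?I = "PIdl (\<one> \<ominus> e)"
  note eD = primitive_idempotentD[OF e]
  have I: "ideal ?I R" using eD(2) by (intro cgenideal_ideal) simp
  have "?I +> \<one> \<noteq> ?I +> \<zero>" using coset_compl_eq_iff[OF eD(1)] eD(2,4) by simp
  then show ?thesis
    using a_coset_add_zero[OF additive_subgroup.a_subset[OF ideal.axioms(1)[OF I]]] by (simp add: FactRing_def)
qed

end

section \<open>Idempotents of product rings and infinite index sets\<close>

lemma ring_iso_idempotents:
  assumes "h \<in> ring_iso R S"
  shows "inj_on h (ring_idempotents R)" "h ` ring_idempotents R \<subseteq> ring_idempotents S"
proof -
  note h = ring_iso_memE[OF assms]
  show "inj_on h (ring_idempotents R)"
    using h(5) unfolding bij_betw_def by (rule conjE) (auto intro: inj_on_subset simp: ring_idempotents_def)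
  show "h ` ring_idempotents R \<subseteq> ring_idempotents S"
    using h(1) h(2)[symmetric] by (auto simp: ring_idempotents_def)
qed

lemma finite_idempotents_if_iso_finite_product:
  assumes "R \<simeq> product_ring I S" "finite I" "\<And>i. i \<in> I \<Longrightarrow> finite (ring_idempotents (S i))"
  shows "finite (ring_idempotents R)"
proof -
  obtain h where "h \<in> ring_iso R (product_ring I S)" using assms(1) unfolding is_ring_iso_def by blast
  note h = ring_iso_idempotents[OF this]
  have "ring_idempotents (product_ring I S) \<subseteq> (\<Pi>\<^sub>E i\<in>I. ring_idempotents (S i))"
  proof
    fix c assume c: "c \<in> ring_idempotents (product_ring I S)"
    then have "(\<lambda>i\<in>I. c i \<otimes>\<^bsub>S i\<^esub> c i) = c" by (simp add: ring_idempotents_def product_ring_def)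
    then have "c i \<otimes>\<^bsub>S i\<^esub> c i = c i" if "i \<in> I" for i using that by (auto dest: fun_cong[of _ _ i])
    then show "c \<in> (\<Pi>\<^sub>E i\<in>I. ring_idempotents (S i))"
      using c by (auto simp: ring_idempotents_def product_ring_def PiE_iff)
  qed
  then have "finite (ring_idempotents (product_ring I S))"
    using finite_PiE[OF assms(2,3)] by (rule finite_subset)
  then show ?thesis using inj_on_finite[OF h] by blast
qed

text \<open>\<open>f\<close> sends a set to its indicator function, transported to \<open>R\<close>.
  Arguments range over all sets of the index type, so that complement is the plain
  \<open>- A\<close>; only \<open>A \<inter> I\<close> matters, and nonzero factors make
  \<open>f\<close> vanish exactly when it is empty.\<close>

lemma (in cring) product_ring_boolean_hom:
  fixes I :: "'i set" and S :: "'i \<Rightarrow> ('c, 'd) ring_scheme"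
  assumes iso: "R \<simeq> product_ring I S"
    and S: "\<And>i. i \<in> I \<Longrightarrow> cring (S i)" "\<And>i. i \<in> I \<Longrightarrow> \<one>\<^bsub>S i\<^esub> \<noteq> \<zero>\<^bsub>S i\<^esub>"
  obtains f :: "'i set \<Rightarrow> 'a" where "\<And>A. f A \<in> carrier R" "\<And>A B. f (A \<inter> B) = f A \<otimes> f B"
    "\<And>A. f (- A) = \<one> \<ominus> f A" "\<And>A. f A = \<zero> \<longleftrightarrow> A \<inter> I = {}"
proof -
  let ?P = "product_ring I S"
  have "?P \<simeq> R" by (rule ring_iso_sym[OF ring_axioms iso])
  then obtain g where giso: "g \<in> ring_iso ?P R" unfolding is_ring_iso_def by blast
  note g = ring_iso_memE[OF giso]
  have cancel: "(u \<oplus> v) \<ominus> u = v" if "u \<in> carrier R" "v \<in> carrier R" for u v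
    using that by algebra
  interpret P: cring ?P by (rule product_ring_cring[OF S(1)])
  note Sr = cring.cring_simprules[OF S(1)]
  let ?ind = "\<lambda>A. \<lambda>i\<in>I. if i \<in> A then \<one>\<^bsub>S i\<^esub> else \<zero>\<^bsub>S i\<^esub>"
  have ind: "?ind A \<in> carrier ?P" for A using Sr(2,6) by (auto simp: product_ring_def)
  have mult: "?ind (A \<inter> B) = ?ind A \<otimes>\<^bsub>?P\<^esub> ?ind B" for A B
    using Sr(2,6,12,24) by (auto simp: product_ring_def cring.cring_simprules[OF S(1)] intro!: restrict_ext)
  have add: "?ind A \<oplus>\<^bsub>?P\<^esub> ?ind (- A) = \<one>\<^bsub>?P\<^esub>" for A
    using Sr(2,6) by (auto simp: product_ring_def cring.cring_simprules[OF S(1)] intro!: restrict_ext)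
  have zero: "?ind A = \<zero>\<^bsub>?P\<^esub> \<longleftrightarrow> A \<inter> I = {}" for A
  proof
    assume *: "?ind A = \<zero>\<^bsub>?P\<^esub>"
    have "i \<notin> A" if "i \<in> I" for i
      using fun_cong[OF *, of i] that S(2)[OF that] by (auto simp: product_ring_def split: if_splits)
    then show "A \<inter> I = {}" by blast
  qed (auto simp: product_ring_def intro!: restrict_ext)
  have "g \<in> ring_hom ?P R" using giso by (simp add: ring_iso_def)
  then have g0: "g \<zero>\<^bsub>?P\<^esub> = \<zero>" by (rule ring_hom_zero[OF _ P.ring_axioms ring_axioms])
  let ?f = "\<lambda>A. g (?ind A)"
  show thesis
  proof (rule that[of ?f])
    fix A B
    show fA: "?f A \<in> carrier R" for A using g(1) ind by blast
    show "?f (A \<inter> B) = ?f A \<otimes> ?f B" unfolding mult by (rule g(2)[OF ind ind])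
    have "?f A \<oplus> ?f (- A) = \<one>" using g(3)[OF ind ind, of A "- A"] add g(4) by simp
    then have "\<one> \<ominus> ?f A = (?f A \<oplus> ?f (- A)) \<ominus> ?f A" by simp
    also have "\<dots> = ?f (- A)" by (rule cancel[OF fA fA])
    finally show "?f (- A) = \<one> \<ominus> ?f A" ..
    have "?f A = \<zero> \<longleftrightarrow> ?ind A = \<zero>\<^bsub>?P\<^esub>"
      using inj_on_eq_iff[OF bij_betw_imp_inj_on[OF g(5)] ind P.zero_closed] g0 by simp
    then show "?f A = \<zero> \<longleftrightarrow> A \<inter> I = {}" unfolding zero .
  qed
qed

text \<open>
  Transporting along a bijection between an infinite set and its finite subsets, the sets
  \<open>{F. i \<in> F}\<close> of finite subsets become the independent family.
\<close>

lemma infinite_imp_independent_family: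
  assumes "infinite A"
  obtains X :: "'a \<Rightarrow> 'a set"
  where "\<And>K L. finite K \<Longrightarrow> K \<subseteq> A \<Longrightarrow> K \<inter> L = {} \<Longrightarrow> L \<subseteq> A \<Longrightarrow>
    \<exists>a\<in>A. (\<forall>i\<in>K. a \<in> X i) \<and> (\<forall>i\<in>L. a \<notin> X i)"
proof -
  obtain h where h: "bij_betw h (Fpow A) A"
    using eqpoll_Fpow[OF assms] unfolding eqpoll_def by blast
  let ?X = "\<lambda>i. {h F | F. F \<in> Fpow A \<and> i \<in> F}"
  show thesis
  proof (rule that[of ?X])
    fix K L assume K: "finite K" "K \<subseteq> A" "K \<inter> L = {}" "L \<subseteq> A"
    \<comment> \<open>The witness is \<open>h K\<close>, the code of \<open>K\<close> itself: by
      injectivity of \<open>h\<close> it lies in \<open>X i\<close> exactly when \<open>i\<close> is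
      in \<open>K\<close>.\<close>
    have KF: "K \<in> Fpow A" using K by (simp add: Fpow_def)
    have "h K \<in> A" using h KF by (meson bij_betwE)
    moreover have "h K \<in> ?X i" if "i \<in> K" for i using KF that by blast
    moreover have "h K \<notin> ?X i" if "i \<in> L" for i
    proof
      assume "h K \<in> ?X i"
      then obtain F where "F \<in> Fpow A" "i \<in> F" "h K = h F" by blast
      then have "i \<in> K" using h KF unfolding bij_betw_def inj_on_def by metis
      then show False using that K(3) by blast
    qed
    ultimately show "\<exists>a\<in>A. (\<forall>i\<in>K. a \<in> ?X i) \<and> (\<forall>i\<in>L. a \<notin> ?X i)" by blast
  qed
qed

text \<open>\<open>f\<close> takes sets of components to idempotents. An infinite
  \<open>\<K>\<close> would carry an independent family indexed by itself, and diagonalizing against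
  it yields a prime in no component.\<close>

lemma (in cring) finite_components_if_boolean_hom:
  fixes f :: "'a set set set \<Rightarrow> 'a"
  defines "\<K> \<equiv> connected_components_of (zariski_topology R)"
  assumes fR: "\<And>A. f A \<in> carrier R" and f_Int: "\<And>A B. f (A \<inter> B) = f A \<otimes> f B"
    and f_Compl: "\<And>A. f (- A) = \<one> \<ominus> f A" and f_zero: "\<And>A. f A = \<zero> \<longleftrightarrow> A \<inter> \<K> = {}"
  shows "finite \<K>"
proof (rule ccontr)
  assume inf: "infinite \<K>"
  obtain X where X: "\<And>K L. finite K \<Longrightarrow> K \<subseteq> \<K> \<Longrightarrow> K \<inter> L = {} \<Longrightarrow> L \<subseteq> \<K> \<Longrightarrow>
    \<exists>a\<in>\<K>. (\<forall>i\<in>K. a \<in> X i) \<and> (\<forall>i\<in>L. a \<notin> X i)"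
    using that by (rule infinite_imp_independent_family[OF inf])
  have idem: "f A \<in> ring_idempotents R" for A
    using fR f_Int[of A A] by (simp add: ring_idempotents_def)
  \<comment> \<open>The idempotent of \<open>X C\<close> lies in all primes of \<open>C\<close> or
    in none of them; in the second case its complement lies in all. Thus \<open>f (Y C)\<close>
    vanishes on \<open>C\<close>.\<close>
  define Y where "Y C = (if \<exists>p\<in>C. f (X C) \<in> p then X C else - X C)" for C
  have Y: "f (Y C) \<in> p" if C: "C \<in> \<K>" and p: "p \<in> C" for C p
  proof -
    have Csub: "C \<subseteq> prime_spectrum R"
      using connected_components_of_subset C unfolding \<K>_def topspace_zariski[symmetric] by blast
    have dich: "C \<subseteq> basic_open R (f A) \<or> C \<inter> basic_open R (f A) = {}" for A
      using component_idempotent_dichotomy[OF _ idem] C unfolding \<K>_def by blast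
    show ?thesis
    proof (cases "\<exists>p\<in>C. f (X C) \<in> p")
      case True
      then have "p \<notin> basic_open R (f (X C))" using dich[of "X C"] p by (auto simp: basic_open_def)
      then show ?thesis using True Csub p by (auto simp: Y_def basic_open_def)
    next
      case False
      have "primeideal p R" using Csub p by (auto simp: prime_spectrum_def)
      then show ?thesis
        using False p idempotent_notin_primeideal_iff[OF _ idem] by (auto simp: Y_def f_Compl)
    qed
  qed
  have f_UNIV: "f UNIV = \<one>"
  proof -
    have "\<one> \<ominus> f UNIV = \<zero>" using f_Compl[of UNIV] f_zero[of "{}"] by simp
    then show ?thesis using fR by simp
  qed
  \<comment> \<open>The elements killed by a finite product of the idempotents
    \<open>f (Y C)\<close>. It contains every 1 - \<open>f (Y C)\<close>, so a prime above it avoids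
    all \<open>f (Y C)\<close>.\<close>
  let ?J = "{x \<in> carrier R. \<exists>K. finite K \<and> K \<subseteq> \<K> \<and> x \<otimes> f (\<Inter>C\<in>K. Y C) = \<zero>}"
  have J: "ideal ?J R"
  proof (rule idealI)
    show "subgroup ?J (add_monoid R)"
    proof (rule add.subgroupI)
      have "finite {}" "{} \<subseteq> \<K>" "\<zero> \<otimes> f (\<Inter>C\<in>{}. Y C) = \<zero>" using fR by auto
      then show "?J \<noteq> {}" by blast
      show "\<ominus> x \<in> ?J" if "x \<in> ?J" for x
        using that fR by (auto simp: l_minus)
      fix x y assume "x \<in> ?J" "y \<in> ?J"
      then obtain K L where x: "x \<in> carrier R" "finite K" "K \<subseteq> \<K>" "x \<otimes> f (\<Inter>C\<in>K. Y C) = \<zero>"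
        and y: "y \<in> carrier R" "finite L" "L \<subseteq> \<K>" "y \<otimes> f (\<Inter>C\<in>L. Y C) = \<zero>" by blast
      let ?a = "f (\<Inter>C\<in>K. Y C)" and ?b = "f (\<Inter>C\<in>L. Y C)"
      have "(\<Inter>C\<in>K \<union> L. Y C) = (\<Inter>C\<in>K. Y C) \<inter> (\<Inter>C\<in>L. Y C)" by blast
      then have "(x \<oplus> y) \<otimes> f (\<Inter>C\<in>K \<union> L. Y C) = (x \<oplus> y) \<otimes> (?a \<otimes> ?b)" by (simp only: f_Int)
      also have "\<dots> = (x \<otimes> ?a) \<otimes> ?b \<oplus> (y \<otimes> ?b) \<otimes> ?a"
        using x(1) y(1) fR[of "\<Inter>C\<in>K. Y C"] fR[of "\<Inter>C\<in>L. Y C"] by algebra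
      also have "\<dots> = \<zero>" using x y fR by simp
      finally have "(x \<oplus> y) \<otimes> f (\<Inter>C\<in>K \<union> L. Y C) = \<zero>" .
      moreover have "finite (K \<union> L)" "K \<union> L \<subseteq> \<K>" using x y by auto
      ultimately show "x \<oplus> y \<in> ?J" using x(1) y(1) by blast
    qed auto
  next
    fix x r assume "x \<in> ?J" and r: "r \<in> carrier R"
    then obtain K where x: "x \<in> carrier R" "finite K" "K \<subseteq> \<K>" "x \<otimes> f (\<Inter>C\<in>K. Y C) = \<zero>" by blast
    then have "(r \<otimes> x) \<otimes> f (\<Inter>C\<in>K. Y C) = \<zero>" using r fR by (simp add: m_assoc)
    then show "r \<otimes> x \<in> ?J" using x r by blast
    then show "x \<otimes> r \<in> ?J" using x(1) r by (simp add: m_comm)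
  qed (rule ring_axioms)
  have "\<one> \<notin> ?J"
  proof
    assume "\<one> \<in> ?J"
    then obtain K where K: "finite K" "K \<subseteq> \<K>" "\<one> \<otimes> f (\<Inter>C\<in>K. Y C) = \<zero>" by blast
    \<comment> \<open>Independence is applied with membership demanded where \<open>Y C\<close> is
      \<open>X C\<close> and non-membership where it is the complement, giving a component in every
      \<open>Y C\<close> with \<open>C\<close> in \<open>K\<close>.\<close>
    let ?K1 = "{C \<in> K. Y C = X C}" and ?K2 = "{C \<in> K. Y C \<noteq> X C}"
    obtain a where a: "a \<in> \<K>" "\<forall>i\<in>?K1. a \<in> X i" "\<forall>i\<in>?K2. a \<notin> X i"
      using X[of ?K1 ?K2] K(1,2) by auto
    have "a \<in> Y C" if "C \<in> K" for C
      using that a(2,3) by (cases "Y C = X C") (auto simp: Y_def split: if_splits)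
    then have "a \<in> (\<Inter>C\<in>K. Y C) \<inter> \<K>" using a(1) by blast
    moreover have "f (\<Inter>C\<in>K. Y C) = \<zero>" using K(3) fR by simp
    ultimately show False unfolding f_zero by blast
  qed
  then obtain p where p: "primeideal p R" "?J \<subseteq> p"
    by (rule exists_primeideal_superset[OF J])
  \<comment> \<open>The diagonal clash: \<open>p\<close> contains \<open>f (Y C)\<close> because it
    lies in its own component \<open>C\<close>, and 1 - \<open>f (Y C)\<close> because it lies above
    \<open>?J\<close>.\<close>
  obtain C where C: "C \<in> \<K>" "p \<in> C" using exists_component[OF p(1)] unfolding \<K>_def by blast
  have "(\<one> \<ominus> f (Y C)) \<otimes> f (\<Inter>C\<in>{C}. Y C) = \<zero>" using idempotent_compl(3)[OF idem] by simp
  moreover have "finite {C}" "{C} \<subseteq> \<K>" "\<one> \<ominus> f (Y C) \<in> carrier R" using C(1) fR by auto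
  ultimately have "\<one> \<ominus> f (Y C) \<in> ?J" by blast
  then show False
    using Y[OF C] p idempotent_notin_primeideal_iff[OF p(1) idem] by blast
qed

lemma (in cring) finitely_generated_if_finite_idempotents:
  assumes "finite (ring_idempotents R)" "regular_ideal R I"
  shows "finitely_generated_ideal R I"
proof -
  obtain S where "S \<subseteq> ring_idempotents R" "I = Idl S"
    using assms(2) unfolding regular_ideal_def by blast
  then show ?thesis
    using finite_subset[OF _ assms(1)] ring_idempotents_subset
    unfolding finitely_generated_ideal_def by (intro exI[of _ S]) auto
qed

section \<open>The equivalences, with finiteness of the set of idempotents as the hub\<close>

theorem theorem5p8:
  fixes R :: "('a, 'b) ring_scheme" (structure)
  assumes "cring R" and "carrier R \<noteq> {\<zero>}"
  shows
    "(finite (connected_components_of (zariski_topology R)) \<longleftrightarrow>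
        finite (ring_idempotents R)) \<and>
     (finite (connected_components_of (zariski_topology R)) \<longleftrightarrow>
        (\<exists>n::nat. n \<ge> 1 \<and> (\<exists>e :: nat \<Rightarrow> 'a.
           (\<forall>k\<in>{1..n}. primitive_idempotent R (e k)) \<and>
           R \<simeq> product_ring {1..n} (\<lambda>k. R Quot (PIdl (\<one> \<ominus> e k)))))) \<and>
     (finite (connected_components_of (zariski_topology R)) \<longleftrightarrow>
        (\<exists>e :: 'a set set \<Rightarrow> 'a.
           (\<forall>C\<in>connected_components_of (zariski_topology R). primitive_idempotent R (e C)) \<and>
           R \<simeq> product_ring (connected_components_of (zariski_topology R))
                 (\<lambda>C. R Quot (PIdl (\<one> \<ominus> e C))))) \<and>
     (finite (connected_components_of (zariski_topology R)) \<longleftrightarrow>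
        (\<exists>S. (\<forall>e\<in>S. primitive_idempotent R e) \<and> Idl S = carrier R)) \<and>
     (finite (connected_components_of (zariski_topology R)) \<longleftrightarrow>
        (\<forall>I. regular_ideal R I \<longrightarrow> finitely_generated_ideal R I)) \<and>
     (finite (connected_components_of (zariski_topology R)) \<longleftrightarrow>
        (\<forall>M. max_regular_ideal R M \<longrightarrow> finitely_generated_ideal R M)) \<and>
     (finite (connected_components_of (zariski_topology R)) \<longleftrightarrow>
        connected_components_of (zariski_topology R) =
          {basic_open R e | e. primitive_idempotent R e})"
    (is "(?i \<longleftrightarrow> ?ii) \<and> (?i \<longleftrightarrow> ?iii) \<and> (?i \<longleftrightarrow> ?iv) \<and> (?i \<longleftrightarrow> ?v) \<and> (?i \<longleftrightarrow> ?vi) \<and> (?i \<longleftrightarrow> ?vii) \<and> (?i \<longleftrightarrow> ?viii)")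
proof -
  interpret cring R by fact
  let ?K = "connected_components_of (zariski_topology R)"
  let ?prim = "{e. primitive_idempotent R e}"
  have i_ii: ?ii if ?i using finite_idempotents_if_finite_components that .
  have ii_gen: "Idl ?prim = carrier R" if ?ii
    using primitive_generate_if_finite_idempotents that .
  have gen_ii: ?ii if "Idl ?prim = carrier R"
    using finite_idempotents_if_primitive_generate[of ?prim] that by simp
  have ii_viii: ?viii if ?ii
    using components_eq_if_primitive_generate[OF ii_gen[OF that]] .
  have viii_ii: ?ii if ?viii
    using gen_ii primitive_generate_if_components_eq that by blast
  have finprim: "finite ?prim" if ?ii
    using that primitive_idempotentD(1) by (metis (no_types, lifting) finite_subset mem_Collect_eq subsetI)
  have ii_i: ?i if ?ii
  proof -
    have "?K = basic_open R ` ?prim" using ii_viii[OF that] by blast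
    then show ?thesis using finprim[OF that] by simp
  qed
  have v_ii: ?ii if ?v using finite_idempotents_if_primitive_generate that by blast
  have ii_v: ?v if ?ii using ii_gen[OF that] by blast
  have ii_vi: ?vi if ?ii using finitely_generated_if_finite_idempotents that by blast
  have vi_vii: ?vii if ?vi using that unfolding max_regular_ideal_def by blast
  have vii_ii: ?ii if ?vii using gen_ii primitive_generate_if_max_regular_fg that by blast
  \<comment> \<open>Kept generic in the index set, so that it serves both an initial segment of the
    naturals and the set of components.\<close>
  have iso: "R \<simeq> product_ring I (\<lambda>i. R Quot PIdl (\<one> \<ominus> e i))"
    if ?ii and bij: "bij_betw e I ?prim" for e :: "'i \<Rightarrow> 'a" and I
  proof (rule ring_iso_product_Quot)
    have e: "primitive_idempotent R (e i)" if "i \<in> I" for i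
      using bij_betwE[OF bij] that by blast
    show "finite I" using finprim[OF \<open>?ii\<close>] bij_betw_finite[OF bij] by blast
    show "e i \<in> ring_idempotents R" if "i \<in> I" for i
      using primitive_idempotentD(1)[OF e[OF that]] .
    show "e i \<otimes> e j = \<zero>" if "i \<in> I" "j \<in> I" "i \<noteq> j" for i j
      using primitive_orthogonal[OF e[OF that(1)] e[OF that(2)]] bij that
      unfolding bij_betw_def inj_on_def by blast
    show "Idl (e ` I) = carrier R" using ii_gen[OF \<open>?ii\<close>] bij by (simp add: bij_betw_def)
  qed
  have ii_iii: ?iii if hyp: ?ii
  proof -
    obtain e where e: "bij_betw e {1..card ?prim} ?prim"
      using ex_bij_betw_nat_finite_1[OF finprim[OF hyp]] by blast
    \<comment> \<open>The empty set generates the zero ideal, so a nonzero ring has a primitive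
      idempotent; this secures \<open>n \<ge> 1\<close>.\<close>
    have "?prim \<noteq> {}"
    proof
      assume "?prim = {}"
      then have "carrier R = {\<zero>}"
        using ii_gen[OF hyp] genideal_minimal[OF zeroideal, of ?prim] zero_closed by auto
      then show False using assms(2) by simp
    qed
    then have "card ?prim \<ge> 1" using finprim[OF hyp] by (simp add: Suc_le_eq card_gt_0_iff)
    moreover have "\<forall>k\<in>{1..card ?prim}. primitive_idempotent R (e k)" using bij_betwE[OF e] by blast
    ultimately show ?thesis using iso[OF hyp e] by blast
  qed
  have iii_ii: ?ii if hyp: ?iii
  proof -
    obtain n e where e: "\<And>k. k \<in> {1..n::nat} \<Longrightarrow> primitive_idempotent R (e k)"
      and iso: "R \<simeq> product_ring {1..n} (\<lambda>k. R Quot (PIdl (\<one> \<ominus> e k)))"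
      using hyp by blast
    \<comment> \<open>Each factor has at most two idempotents, so the finite product has finitely
      many.\<close>
    show ?thesis
      by (rule finite_idempotents_if_iso_finite_product[OF iso])
        (use finite_subset[OF idempotents_Quot_primitive[OF e]] in auto)
  qed
  have ii_iv: ?iv if hyp: ?ii
  proof -
    have inj: "inj_on (basic_open R) ?prim"
      by (rule inj_on_subset[OF basic_open_inj_on]) (auto simp: primitive_idempotent_def)
    have K: "basic_open R ` ?prim = ?K" using ii_viii[OF hyp] by blast
    \<comment> \<open>Each component is indexed by the unique primitive idempotent \<open>e\<close>
      for which it is D(e).\<close>
    have bij: "bij_betw (inv_into ?prim (basic_open R)) ?K ?prim"
      using bij_betw_inv_into[of "basic_open R" ?prim ?K] inj K by (simp add: bij_betw_def)
    moreover have "\<forall>C\<in>?K. primitive_idempotent R (inv_into ?prim (basic_open R) C)"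
      using bij_betwE[OF bij] by blast
    ultimately show ?thesis using iso[OF hyp bij] by blast
  qed
  have iv_i: ?i if hyp: ?iv
  proof -
    obtain e where e: "\<And>C. C \<in> ?K \<Longrightarrow> primitive_idempotent R (e C)"
      and iso: "R \<simeq> product_ring ?K (\<lambda>C. R Quot (PIdl (\<one> \<ominus> e C)))"
      using hyp by blast
    \<comment> \<open>The factors are nonzero, so the subsets of \<open>?K\<close> embed into the
      idempotents of \<open>R\<close> whatever the cardinality of \<open>?K\<close>; the diagonal
      argument then excludes an infinite \<open>?K\<close>.\<close>
    show ?thesis
      by (rule product_ring_boolean_hom[OF iso cring_Quot_compl[OF primitive_idempotentD(1)[OF e]]
          one_neq_zero_Quot_primitive[OF e]])
        (assumption | rule finite_components_if_boolean_hom)+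
  qed
  have "?i \<longleftrightarrow> ?ii" using i_ii ii_i by (rule iffI)
  moreover have "?ii \<longleftrightarrow> ?iii" using ii_iii iii_ii by (rule iffI)
  moreover have "?i \<longleftrightarrow> ?iv" using ii_iv[OF i_ii] iv_i by (rule iffI)
  moreover have "?ii \<longleftrightarrow> ?v" using ii_v v_ii by (rule iffI)
  moreover have "?ii \<longleftrightarrow> ?vi" using ii_vi vii_ii[OF vi_vii] by (rule iffI)
  moreover have "?ii \<longleftrightarrow> ?vii" using vi_vii[OF ii_vi] vii_ii by (rule iffI)
  moreover have "?ii \<longleftrightarrow> ?viii" using ii_viii viii_ii by (rule iffI)
  ultimately show ?thesis by (simp only:)
qed

end
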